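(* Consider the multi-component Curie–Weiss Ising model described in the context, with $\beta>\beta_{cr}$. Then the Glauber dynamics has a mixing time that is exponential in $n$: there is a constant $c>0$ such that $t_{mix}^{(n)}\ge e^{cn}$ for all sufficiently large $n$.
   Context: Fix an integer $m\ge 1$, proportions $p_1,\dots,p_m>0$ with $\sum_i p_i=1$, and a symmetric matrix $\mathbf K=(k_{ij})$ with all $k_{ij}>0$. The parameter $n$ ranges over positive integers with $np_i\in\mathbb N$ for all $i$. The vertex set $V=\{1,\dots,n\}$ is partitioned into blocks $G_1,\dots,G_m$ with $|G_i|=np_i$; for $v\in G_i,w\in G_j$ put $K(v,w)=k_{ij}/n$. On $\Omega=\{-1,+1\}^V$ the Gibbs measure at inverse temperature $\beta$ is $\mu_n(\sigma)\propto\exp\big(\beta\sum_{\{v,w\},v\ne w}K(v,w)\sigma(v)\sigma(w)\big)$. The Glauber dynamics picks at each step a uniformly random vertex $v$ and sets its spin to $\pm1$ with probability $\frac{1\pm\tanh(\beta S^v)}{2}$, $S^v=\sum_{w\ne v}K(v,w)\sigma(w)$. Let $d_n(t)=\max_\sigma\|\mathbb P_\sigma(\sigma_t\in\cdot)-\mu_n\|_{TV}$ and $t_{mix}^{(n)}=\min\{t:d_n(t)\le1/4\}$. Let $\mathbf B=(p_ik_{ij})$, $\mathbf a>0$ its left Perron eigenvector with $\|\mathbf a\|_1=1$, and $\beta_{cr}=(\sum_{i,j}a_ip_ik_{ij})^{-1}$. *)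

theory Defs
  imports Complex_Main
begin

text \<open>Vertices are 0,...,n-1. A block assignment g maps each vertex to its block
(an element of the finite index type 'i). Spin configurations are functions
nat => real with values +1/-1 on vertices and 0 outside.\<close>

definition Conf :: "nat \<Rightarrow> (nat \<Rightarrow> real) set" where
  "Conf n = {\<sigma>. (\<forall>v<n. \<sigma> v = 1 \<or> \<sigma> v = -1) \<and> (\<forall>v. n \<le> v \<longrightarrow> \<sigma> v = 0)}"

definition Kint :: "('i \<Rightarrow> 'i \<Rightarrow> real) \<Rightarrow> (nat \<Rightarrow> 'i) \<Rightarrow> nat \<Rightarrow> nat \<Rightarrow> nat \<Rightarrow> real" where
  "Kint k g n v w = k (g v) (g w) / real n"

definition energy :: "('i \<Rightarrow> 'i \<Rightarrow> real) \<Rightarrow> (nat \<Rightarrow> 'i) \<Rightarrow> nat \<Rightarrow> (nat \<Rightarrow> real) \<Rightarrow> real" where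
  "energy k g n \<sigma> = (\<Sum>v<n. \<Sum>w\<in>{v<..<n}. Kint k g n v w * \<sigma> v * \<sigma> w)"

definition gibbs :: "real \<Rightarrow> ('i \<Rightarrow> 'i \<Rightarrow> real) \<Rightarrow> (nat \<Rightarrow> 'i) \<Rightarrow> nat \<Rightarrow> (nat \<Rightarrow> real) \<Rightarrow> real" where
  "gibbs \<beta> k g n \<sigma> = exp (\<beta> * energy k g n \<sigma>) / (\<Sum>\<tau>\<in>Conf n. exp (\<beta> * energy k g n \<tau>))"

definition local_field :: "('i \<Rightarrow> 'i \<Rightarrow> real) \<Rightarrow> (nat \<Rightarrow> 'i) \<Rightarrow> nat \<Rightarrow> (nat \<Rightarrow> real) \<Rightarrow> nat \<Rightarrow> real" where
  "local_field k g n \<sigma> v = (\<Sum>w\<in>{..<n} - {v}. Kint k g n v w * \<sigma> w)"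

definition glauber :: "real \<Rightarrow> ('i \<Rightarrow> 'i \<Rightarrow> real) \<Rightarrow> (nat \<Rightarrow> 'i) \<Rightarrow> nat \<Rightarrow> (nat \<Rightarrow> real) \<Rightarrow> (nat \<Rightarrow> real) \<Rightarrow> real" where
  "glauber \<beta> k g n \<sigma> \<tau> = (1 / real n) * (\<Sum>v<n.
      (if (\<forall>u. u \<noteq> v \<longrightarrow> \<tau> u = \<sigma> u)
       then (1 + \<tau> v * tanh (\<beta> * local_field k g n \<sigma> v)) / 2 else 0))"

fun glauber_pow :: "real \<Rightarrow> ('i \<Rightarrow> 'i \<Rightarrow> real) \<Rightarrow> (nat \<Rightarrow> 'i) \<Rightarrow> nat \<Rightarrow> nat \<Rightarrow> (nat \<Rightarrow> real) \<Rightarrow> (nat \<Rightarrow> real) \<Rightarrow> real" where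
  "glauber_pow \<beta> k g n 0 \<sigma> \<tau> = (if \<sigma> = \<tau> then 1 else 0)"
| "glauber_pow \<beta> k g n (Suc t) \<sigma> \<tau> =
     (\<Sum>\<rho>\<in>Conf n. glauber_pow \<beta> k g n t \<sigma> \<rho> * glauber \<beta> k g n \<rho> \<tau>)"

definition dist_mix :: "real \<Rightarrow> ('i \<Rightarrow> 'i \<Rightarrow> real) \<Rightarrow> (nat \<Rightarrow> 'i) \<Rightarrow> nat \<Rightarrow> nat \<Rightarrow> real" where
  "dist_mix \<beta> k g n t = Max ((\<lambda>\<sigma>. (1/2) * (\<Sum>\<tau>\<in>Conf n. \<bar>glauber_pow \<beta> k g n t \<sigma> \<tau> - gibbs \<beta> k g n \<tau>\<bar>)) ` Conf n)"

definition mixing_time :: "real \<Rightarrow> ('i \<Rightarrow> 'i \<Rightarrow> real) \<Rightarrow> (nat \<Rightarrow> 'i) \<Rightarrow> nat \<Rightarrow> nat" where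
  "mixing_time \<beta> k g n = (LEAST t. dist_mix \<beta> k g n t \<le> 1/4)"

text \<open>a is the left Perron eigenvector of B = (p_i k_ij), normalized to l1-norm 1
(a positive left eigenvector of a positive matrix is the Perron one).\<close>
definition left_perron_vector :: "('i::finite \<Rightarrow> real) \<Rightarrow> ('i \<Rightarrow> 'i \<Rightarrow> real) \<Rightarrow> ('i \<Rightarrow> real) \<Rightarrow> bool" where
  "left_perron_vector p k a \<longleftrightarrow> (\<forall>i. a i > 0) \<and> (\<Sum>i\<in>UNIV. a i) = 1 \<and>
     (\<exists>r. \<forall>j. (\<Sum>i\<in>UNIV. a i * (p i * k i j)) = r * a j)"

definition beta_cr :: "('i::finite \<Rightarrow> real) \<Rightarrow> ('i \<Rightarrow> 'i \<Rightarrow> real) \<Rightarrow> ('i \<Rightarrow> real) \<Rightarrow> real" where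
  "beta_cr p k a = 1 / (\<Sum>i\<in>UNIV. \<Sum>j\<in>UNIV. a i * p i * k i j)"

end

theory Submission
  imports Defs
begin

text \<open>The bottleneck is the set of configurations of total magnetization at most 2 in absolute
  value, which separates two halves exchanged by the global spin flip. It carries exponentially
  small Gibbs mass. If some block magnetizations are of order \<open>n\<close>, they have mixed
  signs, and flipping the negative blocks raises the energy by order \<open>n\<close> because all
  couplings are positive. If all are below \<open>\<epsilon> * n\<close>, the weight is at most
  \<open>exp (O(\<epsilon>\<^sup>2) * n)\<close> per configuration, whereas for \<open>\<beta> > \<beta>\<^sub>c\<^sub>r\<close> the Gibbs variational principle,
  tested on a product measure tilted slightly along the Perron vector, shows that the partition
  function exceeds \<open>2^n\<close> by an exponential factor. Convergence of the chain is also
  needed, because \<^const>\<open>mixing_time\<close> is a \<open>LEAST\<close>, unspecified on an empty predicate.\<close>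

subsection \<open>Finite Markov chains\<close>

text \<open>The recursion copies that of \<open>glauber_pow\<close>, splitting off the last step, so
  that the two are identified at once in \<open>glauber_pow_eq\<close>.\<close>

primrec kernel_pow :: "'s set \<Rightarrow> ('s \<Rightarrow> 's \<Rightarrow> real) \<Rightarrow> nat \<Rightarrow> 's \<Rightarrow> 's \<Rightarrow> real" where
  "kernel_pow S P 0 = (\<lambda>x y. if x = y then 1 else 0)"
| "kernel_pow S P (Suc t) = (\<lambda>x y. \<Sum>z\<in>S. kernel_pow S P t x z * P z y)"

locale finite_chain =
  fixes S :: "'s set" and P :: "'s \<Rightarrow> 's \<Rightarrow> real" and \<pi> :: "'s \<Rightarrow> real"
  assumes finite_S: "finite S"
    and P_nonneg: "\<lbrakk>x \<in> S; y \<in> S\<rbrakk> \<Longrightarrow> 0 \<le> P x y"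
    and P_row: "x \<in> S \<Longrightarrow> (\<Sum>y\<in>S. P x y) = 1"
    and \<pi>_nonneg: "x \<in> S \<Longrightarrow> 0 \<le> \<pi> x"
    and \<pi>_sum: "(\<Sum>x\<in>S. \<pi> x) = 1"
    and stationary: "y \<in> S \<Longrightarrow> (\<Sum>x\<in>S. \<pi> x * P x y) = \<pi> y"
begin

abbreviation pow :: "nat \<Rightarrow> 's \<Rightarrow> 's \<Rightarrow> real" where
  "pow \<equiv> kernel_pow S P"

definition tv :: "nat \<Rightarrow> 's \<Rightarrow> real" where
  "tv t x = (1/2) * (\<Sum>y\<in>S. \<bar>pow t x y - \<pi> y\<bar>)"

text \<open>The stationary probability flow out of \<open>A\<close>: the numerator of the bottleneck
  ratio (conductance) of \<open>A\<close>.\<close>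

definition flow :: "'s set \<Rightarrow> real" where
  "flow A = (\<Sum>x\<in>A. \<Sum>y\<in>S - A. \<pi> x * P x y)"

lemma pow_nonneg: "\<lbrakk>x \<in> S; y \<in> S\<rbrakk> \<Longrightarrow> 0 \<le> pow t x y"
  by (induction t arbitrary: y) (auto intro!: sum_nonneg P_nonneg mult_nonneg_nonneg)

lemma pow_row: "x \<in> S \<Longrightarrow> (\<Sum>y\<in>S. pow t x y) = 1"
proof (induction t)
  case 0
  then show ?case using finite_S by simp
next
  case (Suc t)
  have "(\<Sum>y\<in>S. pow (Suc t) x y) = (\<Sum>z\<in>S. pow t x z * (\<Sum>y\<in>S. P z y))"
    by (simp add: sum_distrib_left) (rule sum.swap)
  also have "\<dots> = 1" using Suc by (simp add: P_row)
  finally show ?case .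
qed

lemma pow_stationary: "y \<in> S \<Longrightarrow> (\<Sum>x\<in>S. \<pi> x * pow t x y) = \<pi> y"
proof (induction t arbitrary: y)
  case 0
  have "(\<Sum>x\<in>S. \<pi> x * pow 0 x y) = (\<Sum>x\<in>S. if x = y then \<pi> x else 0)"
    by (rule sum.cong) auto
  then show ?case using finite_S 0 by simp
next
  case (Suc t)
  have "(\<Sum>x\<in>S. \<pi> x * pow (Suc t) x y) = (\<Sum>x\<in>S. \<Sum>z\<in>S. \<pi> x * pow t x z * P z y)"
    by (simp add: sum_distrib_left mult.assoc)
  also have "\<dots> = (\<Sum>z\<in>S. (\<Sum>x\<in>S. \<pi> x * pow t x z) * P z y)"
    by (subst sum.swap) (simp add: sum_distrib_right)
  also have "\<dots> = \<pi> y" using Suc by (simp add: stationary)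
  finally show ?case .
qed

lemma pow_add:
  "\<lbrakk>x \<in> S; y \<in> S\<rbrakk> \<Longrightarrow> pow (t + s) x y = (\<Sum>z\<in>S. pow t x z * pow s z y)"
proof (induction s arbitrary: y)
  case 0
  have "(\<Sum>z\<in>S. pow t x z * pow 0 z y) = (\<Sum>z\<in>S. if z = y then pow t x z else 0)"
    by (rule sum.cong) auto
  then show ?case using finite_S 0 by simp
next
  case (Suc s)
  have "pow (t + Suc s) x y = (\<Sum>w\<in>S. (\<Sum>z\<in>S. pow t x z * pow s z w) * P w y)"
    using Suc by simp
  also have "\<dots> = (\<Sum>w\<in>S. \<Sum>z\<in>S. pow t x z * (pow s z w * P w y))"
    by (simp add: sum_distrib_right mult.assoc)
  also have "\<dots> = (\<Sum>z\<in>S. pow t x z * pow (Suc s) z y)"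
    by (subst sum.swap) (simp add: sum_distrib_left)
  finally show ?case .
qed

text \<open>By stationarity, the chain started from \<open>\<pi>\<close> restricted to \<open>A\<close> stays below \<open>\<pi>\<close>,
  so in each step at most \<open>flow A\<close> can leave \<open>A\<close>.\<close>

lemma escape_le_flow:
  assumes "A \<subseteq> S"
  shows "(\<Sum>x\<in>A. \<Sum>y\<in>S - A. \<pi> x * pow t x y) \<le> real t * flow A"
proof (induction t)
  case 0
  have "(\<Sum>x\<in>A. \<Sum>y\<in>S - A. \<pi> x * pow 0 x y) = 0"
    by (intro sum.neutral ballI) auto
  then show ?case by simp
next
  case (Suc t)
  \<comment> \<open>\<open>\<nu>\<close> is the law at time \<open>t\<close> of the chain started
    from \<open>\<pi>\<close> restricted to \<open>A\<close>. It is an unnormalised measure, and its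
    mass outside \<open>A\<close> is the quantity bounded by the induction hypothesis.\<close>
  define \<nu> where "\<nu> z = (\<Sum>x\<in>A. \<pi> x * pow t x z)" for z
  have \<nu>_nonneg: "0 \<le> \<nu> z" if "z \<in> S" for z
    unfolding \<nu>_def using that assms
    by (intro sum_nonneg mult_nonneg_nonneg \<pi>_nonneg pow_nonneg) auto
  have \<nu>_le: "\<nu> z \<le> \<pi> z" if "z \<in> S" for z
  proof -
    have "\<nu> z \<le> (\<Sum>x\<in>S. \<pi> x * pow t x z)"
      unfolding \<nu>_def using that assms finite_S
      by (intro sum_mono2 mult_nonneg_nonneg \<pi>_nonneg pow_nonneg) auto
    then show ?thesis using pow_stationary[OF that] by simp
  qed
  have out_nonneg: "0 \<le> (\<Sum>y\<in>S - A. P z y)" if "z \<in> S" for z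
    using that by (intro sum_nonneg P_nonneg) auto
  have out_le: "(\<Sum>y\<in>S - A. P z y) \<le> 1" if "z \<in> S" for z
  proof -
    have "(\<Sum>y\<in>S - A. P z y) \<le> (\<Sum>y\<in>S. P z y)"
      using that finite_S by (intro sum_mono2 P_nonneg) auto
    then show ?thesis using P_row[OF that] by simp
  qed
  have "(\<Sum>x\<in>A. \<Sum>y\<in>S - A. \<pi> x * pow (Suc t) x y)
      = (\<Sum>x\<in>A. \<Sum>y\<in>S - A. \<Sum>z\<in>S. \<pi> x * pow t x z * P z y)"
    by (simp add: sum_distrib_left mult.assoc)
  also have "\<dots> = (\<Sum>x\<in>A. \<Sum>z\<in>S. \<Sum>y\<in>S - A. \<pi> x * pow t x z * P z y)"
    by (intro sum.cong refl sum.swap)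
  also have "\<dots> = (\<Sum>z\<in>S. \<nu> z * (\<Sum>y\<in>S - A. P z y))"
    unfolding \<nu>_def sum_distrib_right by (subst sum.swap) (simp add: sum_distrib_left)
  also have "\<dots> = (\<Sum>z\<in>A. \<nu> z * (\<Sum>y\<in>S - A. P z y)) + (\<Sum>z\<in>S - A. \<nu> z * (\<Sum>y\<in>S - A. P z y))"
    by (subst sum.subset_diff[OF assms finite_S]) (rule add.commute)
  \<comment> \<open>Mass still in \<open>A\<close> is dominated by \<open>\<pi>\<close>, so what
    leaves now is at most \<open>flow A\<close>; for mass already outside, the one-step probability
    is bounded by 1.\<close>
  also have "\<dots> \<le> (\<Sum>z\<in>A. \<pi> z * (\<Sum>y\<in>S - A. P z y)) + (\<Sum>z\<in>S - A. \<nu> z * 1)"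
    using assms \<nu>_nonneg \<nu>_le out_nonneg out_le
    by (intro add_mono sum_mono mult_right_mono mult_left_mono) auto
  also have "(\<Sum>z\<in>A. \<pi> z * (\<Sum>y\<in>S - A. P z y)) = flow A"
    unfolding flow_def by (simp add: sum_distrib_left)
  also have "(\<Sum>z\<in>S - A. \<nu> z * 1) = (\<Sum>x\<in>A. \<Sum>y\<in>S - A. \<pi> x * pow t x y)"
    unfolding \<nu>_def by simp (rule sum.swap)
  also have "flow A + \<dots> \<le> flow A + real t * flow A"
    using Suc by simp
  finally show ?case by (simp add: algebra_simps)
qed

section \<open>Total variation distance: the bottleneck bound and geometric convergence\<close>

lemma mass_diff_le_tv:
  assumes "x \<in> S" "B \<subseteq> S"
  shows "(\<Sum>y\<in>B. \<pi> y) - (\<Sum>y\<in>B. pow t x y) \<le> tv t x"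
proof -
  define d where "d y = \<pi> y - pow t x y" for y
  have split: "(\<Sum>y\<in>S. f y) = (\<Sum>y\<in>S - B. f y) + (\<Sum>y\<in>B. f y)" for f :: "'s \<Rightarrow> real"
    using sum.subset_diff[OF assms(2) finite_S] .
  \<comment> \<open>Two probability vectors are compared, so the masses of \<open>d\<close> on
    \<open>B\<close> and on its complement are opposite. This accounts for the factor 1/2 in
    \<open>tv\<close>.\<close>
  have "(\<Sum>y\<in>S. d y) = 0"
    unfolding d_def by (simp add: sum_subtractf \<pi>_sum pow_row assms)
  then have "2 * (\<Sum>y\<in>B. d y) = (\<Sum>y\<in>B. d y) - (\<Sum>y\<in>S - B. d y)"
    using split[of d] by simp
  also have "\<dots> \<le> (\<Sum>y\<in>B. \<bar>d y\<bar>) + (\<Sum>y\<in>S - B. \<bar>d y\<bar>)"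
  proof -
    have "(\<Sum>y\<in>B. d y) \<le> (\<Sum>y\<in>B. \<bar>d y\<bar>)" "- (\<Sum>y\<in>S - B. d y) \<le> (\<Sum>y\<in>S - B. \<bar>d y\<bar>)"
      by (auto simp flip: sum_negf intro!: sum_mono)
    then show ?thesis by simp
  qed
  also have "\<dots> = 2 * tv t x"
    using split[of "\<lambda>y. \<bar>d y\<bar>"] unfolding tv_def d_def by (simp add: abs_minus_commute)
  finally show ?thesis unfolding d_def by (simp add: sum_subtractf)
qed

text \<open>A chain within 1/4 of equilibrium has put mass at least 1/2 - 1/4 outside
  \<open>A\<close>. Averaging this over starting points in \<open>A\<close> with weight
  \<open>\<pi>\<close> and comparing with \<open>escape_le_flow\<close> bounds \<open>t\<close> from
  below.\<close>

lemma bottleneck: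
  assumes A: "A \<subseteq> S" and half: "1/2 \<le> (\<Sum>y\<in>S - A. \<pi> y)" and tv: "\<forall>x\<in>A. tv t x \<le> 1/4"
  shows "(\<Sum>x\<in>A. \<pi> x) / 4 \<le> real t * flow A"
proof -
  have "(\<Sum>x\<in>A. \<pi> x) / 4 = (\<Sum>x\<in>A. \<pi> x * (1/4))"
    by (simp add: sum_divide_distrib)
  also have "\<dots> \<le> (\<Sum>x\<in>A. \<pi> x * (\<Sum>y\<in>S - A. pow t x y))"
  proof (intro sum_mono mult_left_mono)
    fix x assume x: "x \<in> A"
    then have "(\<Sum>y\<in>S - A. \<pi> y) - (\<Sum>y\<in>S - A. pow t x y) \<le> tv t x"
      using A by (intro mass_diff_le_tv) auto
    then show "1/4 \<le> (\<Sum>y\<in>S - A. pow t x y)"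
      using half tv x by fastforce
    show "0 \<le> \<pi> x" using A x \<pi>_nonneg by auto
  qed
  also have "\<dots> \<le> real t * flow A"
    using escape_le_flow[OF A, of t] by (simp add: sum_distrib_left)
  finally show ?thesis .
qed

text \<open>Doeblin's argument. The signed vector \<open>d\<close> has total mass 0, so subtracting
  \<open>\<delta> * \<pi> y\<close> from the \<open>s\<close>-step kernel does not change its action
  on \<open>d\<close>; what remains is a nonnegative kernel with row sums
  \<open>1 - \<delta>\<close>.\<close>

lemma tv_contract:
  assumes minor: "\<And>x y. \<lbrakk>x \<in> S; y \<in> S\<rbrakk> \<Longrightarrow> \<delta> * \<pi> y \<le> pow s x y" and x: "x \<in> S"
  shows "tv (t + s) x \<le> (1 - \<delta>) * tv t x"
proof -
  define d where "d z = pow t x z - \<pi> z" for z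
  have d0: "(\<Sum>z\<in>S. d z) = 0"
    unfolding d_def by (simp add: sum_subtractf \<pi>_sum pow_row x)
  have *: "pow (t + s) x y - \<pi> y = (\<Sum>z\<in>S. d z * (pow s z y - \<delta> * \<pi> y))" if "y \<in> S" for y
  proof -
    have "(\<Sum>z\<in>S. d z * (pow s z y - \<delta> * \<pi> y)) = (\<Sum>z\<in>S. d z * pow s z y) - (\<Sum>z\<in>S. d z) * (\<delta> * \<pi> y)"
      by (simp add: right_diff_distrib sum_subtractf sum_distrib_right)
    also have "\<dots> = pow (t + s) x y - \<pi> y"
      unfolding d0 unfolding d_def
      by (simp add: left_diff_distrib sum_subtractf pow_add x that pow_stationary)
    finally show ?thesis by simp
  qed
  have "(\<Sum>y\<in>S. \<bar>pow (t + s) x y - \<pi> y\<bar>) \<le> (\<Sum>y\<in>S. \<Sum>z\<in>S. \<bar>d z\<bar> * (pow s z y - \<delta> * \<pi> y))"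
  proof (rule sum_mono)
    fix y assume y: "y \<in> S"
    have "\<bar>pow (t + s) x y - \<pi> y\<bar> \<le> (\<Sum>z\<in>S. \<bar>d z * (pow s z y - \<delta> * \<pi> y)\<bar>)"
      unfolding *[OF y] by (rule sum_abs)
    also have "\<dots> = (\<Sum>z\<in>S. \<bar>d z\<bar> * (pow s z y - \<delta> * \<pi> y))"
      using minor y by (intro sum.cong refl) (simp add: abs_mult)
    finally show "\<bar>pow (t + s) x y - \<pi> y\<bar> \<le> (\<Sum>z\<in>S. \<bar>d z\<bar> * (pow s z y - \<delta> * \<pi> y))" .
  qed
  also have "\<dots> = (\<Sum>z\<in>S. \<bar>d z\<bar> * (\<Sum>y\<in>S. pow s z y - \<delta> * \<pi> y))"
    by (subst sum.swap) (simp add: sum_distrib_left)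
  also have "\<dots> = (\<Sum>z\<in>S. \<bar>d z\<bar> * (1 - \<delta>))"
    by (intro sum.cong refl) (simp add: sum_subtractf pow_row \<pi>_sum flip: sum_distrib_left)
  also have "\<dots> = (1 - \<delta>) * (\<Sum>z\<in>S. \<bar>d z\<bar>)"
    by (simp add: sum_distrib_left mult.commute)
  finally show ?thesis unfolding tv_def d_def by simp
qed

lemma tv_le_1: "x \<in> S \<Longrightarrow> tv t x \<le> 1"
proof -
  assume x: "x \<in> S"
  have "(\<Sum>y\<in>S. \<bar>pow t x y - \<pi> y\<bar>) \<le> (\<Sum>y\<in>S. pow t x y + \<pi> y)"
    using pow_nonneg[OF x] \<pi>_nonneg by (intro sum_mono) (auto simp: abs_if add_increasing)
  also have "\<dots> = 2" by (simp add: sum.distrib pow_row[OF x] \<pi>_sum)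
  finally show ?thesis unfolding tv_def by simp
qed

lemma tv_eventually_le:
  assumes pos: "\<And>x y. \<lbrakk>x \<in> S; y \<in> S\<rbrakk> \<Longrightarrow> 0 < pow s x y" and e: "0 < e"
  shows "\<exists>t. \<forall>x\<in>S. tv t x \<le> e"
proof -
  \<comment> \<open>Inserting 1 guarantees \<open>\<delta> \<le> 1\<close>, so that
    \<open>1 - \<delta>\<close> is a legitimate contraction factor, and keeps the set
    nonempty.\<close>
  define \<delta> where "\<delta> = Min (insert 1 ((\<lambda>(x, y). pow s x y) ` (S \<times> S)))"
  have fin: "finite (insert 1 ((\<lambda>(x, y). pow s x y) ` (S \<times> S)))"
    using finite_S by simp
  have \<delta>: "0 < \<delta>" "\<delta> \<le> 1"
    unfolding \<delta>_def using pos by (auto simp: Min_gr_iff[OF fin] intro!: Min_le[OF fin])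
  have \<delta>_le: "\<delta> \<le> pow s x y" if "x \<in> S" "y \<in> S" for x y
    unfolding \<delta>_def using that by (intro Min_le[OF fin]) force
  have \<pi>_le: "\<pi> y \<le> 1" if "y \<in> S" for y
    using member_le_sum[of y S \<pi>] that finite_S \<pi>_nonneg \<pi>_sum by auto
  have minor: "\<delta> * \<pi> y \<le> pow s x y" if "x \<in> S" "y \<in> S" for x y
    using mult_left_le[OF \<pi>_le[OF that(2)], of \<delta>] \<delta>(1) \<delta>_le[OF that] by linarith
  have geom: "tv (j * s) x \<le> (1 - \<delta>) ^ j" if x: "x \<in> S" for j x
  proof (induction j)
    case 0
    then show ?case using tv_le_1[OF x] by simp
  next
    case (Suc j)
    have "tv (Suc j * s) x \<le> (1 - \<delta>) * tv (j * s) x"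
      using tv_contract[OF minor x, of "j * s"] by (simp add: add.commute)
    also have "\<dots> \<le> (1 - \<delta>) * (1 - \<delta>) ^ j"
      using Suc \<delta> by (intro mult_left_mono) auto
    finally show ?case by simp
  qed
  obtain j where "(1 - \<delta>) ^ j < e"
    using real_arch_pow_inv[OF e, of "1 - \<delta>"] \<delta> by auto
  then show ?thesis using geom by (meson less_imp_le order_trans)
qed

end

subsection \<open>Sums over spin configurations\<close>

lemma finite_Conf: "finite (Conf n)"
proof -
  have "Conf n \<subseteq> {\<sigma>. \<forall>v. (v \<in> {..<n} \<longrightarrow> \<sigma> v \<in> {1, -1}) \<and> (v \<notin> {..<n} \<longrightarrow> \<sigma> v = 0)}"
    by (auto simp: Conf_def)
  moreover have "finite \<dots>" by (rule finite_set_of_finite_funs) auto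
  ultimately show ?thesis by (rule finite_subset)
qed

lemma Conf_spin: "\<lbrakk>\<sigma> \<in> Conf n; v < n\<rbrakk> \<Longrightarrow> \<sigma> v = 1 \<or> \<sigma> v = -1"
  by (auto simp: Conf_def)

lemma Conf_mult:
  assumes "\<sigma> \<in> Conf n" "\<And>v. v < n \<Longrightarrow> \<epsilon> v = 1 \<or> \<epsilon> v = -1"
  shows "(\<lambda>v. \<epsilon> v * \<sigma> v) \<in> Conf n"
  unfolding Conf_def
proof (intro CollectI conjI allI impI)
  fix v assume "v < n"
  then show "\<epsilon> v * \<sigma> v = 1 \<or> \<epsilon> v * \<sigma> v = - 1"
    using Conf_spin[OF assms(1)] assms(2) by fastforce
next
  fix v assume "n \<le> v"
  then show "\<epsilon> v * \<sigma> v = 0" using assms(1) by (simp add: Conf_def)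
qed

text \<open>Multiplication by a fixed sign pattern is an involution of \<open>Conf n\<close>.
  Applied below to patterns that are constant on blocks.\<close>

lemma sum_Conf_mult:
  assumes "\<And>v. \<epsilon> v = 1 \<or> \<epsilon> v = -(1::real)"
  shows "(\<Sum>\<sigma>\<in>Conf n. f (\<lambda>v. \<epsilon> v * \<sigma> v)) = (\<Sum>\<sigma>\<in>Conf n. f \<sigma>)"
proof -
  have "\<epsilon> v * (\<epsilon> v * x) = x" for v x using assms[of v] by auto
  then show ?thesis
    by (intro sum.reindex_bij_witness[of _ "\<lambda>\<sigma> v. \<epsilon> v * \<sigma> v" "\<lambda>\<sigma> v. \<epsilon> v * \<sigma> v"])
      (auto intro!: Conf_mult assms)
qed

lemma Conf_nonempty: "Conf n \<noteq> {}"
proof -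
  have "(\<lambda>v. if v < n then 1 else 0) \<in> Conf n" by (simp add: Conf_def)
  then show ?thesis by blast
qed

lemma Conf_0: "Conf 0 = {\<lambda>_. 0}"
  by (auto simp: Conf_def)

lemma Conf_Suc: "Conf (Suc n) = (\<lambda>\<sigma>. \<sigma>(n := 1)) ` Conf n \<union> (\<lambda>\<sigma>. \<sigma>(n := -1)) ` Conf n"
proof (intro equalityI subsetI)
  fix \<sigma> assume "\<sigma> \<in> Conf (Suc n)"
  then have "\<sigma>(n := 0) \<in> Conf n" "\<sigma> n = 1 \<or> \<sigma> n = -1"
    by (auto simp: Conf_def)
  moreover have "\<sigma> = (\<sigma>(n := 0))(n := \<sigma> n)" by simp
  ultimately show "\<sigma> \<in> (\<lambda>\<sigma>. \<sigma>(n := 1)) ` Conf n \<union> (\<lambda>\<sigma>. \<sigma>(n := -1)) ` Conf n"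
    by (metis UnI1 UnI2 imageI)
qed (auto simp: Conf_def less_Suc_eq)

lemma sum_Conf_Suc:
  "(\<Sum>\<sigma>\<in>Conf (Suc n). f \<sigma>) = (\<Sum>\<sigma>\<in>Conf n. f (\<sigma>(n := 1)) + f (\<sigma>(n := -1)))"
proof -
  have inj: "inj_on (\<lambda>\<sigma>. \<sigma>(n := s)) (Conf n)" for s :: real
  proof (rule inj_onI)
    fix \<sigma> \<tau> assume "\<sigma> \<in> Conf n" "\<tau> \<in> Conf n" and eq: "\<sigma>(n := s) = \<tau>(n := s)"
    then have "\<sigma> n = \<tau> n" by (simp add: Conf_def)
    moreover have "\<sigma> v = \<tau> v" if "v \<noteq> n" for v using fun_cong[OF eq, of v] that by simp
    ultimately show "\<sigma> = \<tau>" by (metis ext)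
  qed
  have "(\<lambda>\<sigma>. \<sigma>(n := 1)) ` Conf n \<inter> (\<lambda>\<sigma>. \<sigma>(n := -1)) ` Conf n = {}"
    by (auto dest!: fun_cong[where x = n])
  then show ?thesis
    unfolding Conf_Suc
    by (simp add: sum.union_disjoint finite_Conf sum.reindex[OF inj] sum.distrib)
qed

lemma sum_prod_Conf:
  "(\<Sum>\<sigma>\<in>Conf n. \<Prod>v<n. f v (\<sigma> v)) = (\<Prod>v<n. f v 1 + f v (-1) :: real)"
proof (induction n)
  case 0
  then show ?case by (simp add: Conf_0)
next
  case (Suc n)
  have *: "(\<Prod>v<n. f v (if v = n then s else \<sigma> v)) = (\<Prod>v<n. f v (\<sigma> v))" for s \<sigma>
    by (rule prod.cong) auto
  show ?case
    by (simp add: sum_Conf_Suc * sum.distrib distrib_left flip: Suc sum_distrib_right)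
qed

lemma card_Conf: "real (card (Conf n)) = 2 ^ n"
  using sum_prod_Conf[of "\<lambda>_ _. 1" n] by simp

section \<open>Product measures and the Gibbs variational bound\<close>

definition product_weight :: "nat \<Rightarrow> (nat \<Rightarrow> real) \<Rightarrow> (nat \<Rightarrow> real) \<Rightarrow> real" where
  "product_weight n t \<sigma> = (\<Prod>v<n. (1 + t v * \<sigma> v) / 2)"

lemma product_weight_sum: "(\<Sum>\<sigma>\<in>Conf n. product_weight n t \<sigma>) = 1"
  unfolding product_weight_def
  by (subst sum_prod_Conf[of "\<lambda>v s. (1 + t v * s) / 2"]) (simp flip: add_divide_distrib)

text \<open>Under \<open>product_weight\<close> the spins are independent with means
  \<open>t v\<close>. Absorbing \<open>\<phi>\<close> into the factor of \<open>v\<close> lets the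
  sum factorise by \<open>sum_prod_Conf\<close>, and every other factor sums to 1.\<close>

lemma product_weight_single:
  assumes "v < n"
  shows "(\<Sum>\<sigma>\<in>Conf n. product_weight n t \<sigma> * \<phi> (\<sigma> v))
       = (1 + t v) / 2 * \<phi> 1 + (1 - t v) / 2 * \<phi> (-1)"
proof -
  have "(\<Sum>\<sigma>\<in>Conf n. product_weight n t \<sigma> * \<phi> (\<sigma> v))
      = (\<Sum>\<sigma>\<in>Conf n. \<Prod>u<n. (1 + t u * \<sigma> u) / 2 * (if u = v then \<phi> (\<sigma> u) else 1))"
    using assms by (simp add: product_weight_def prod.distrib del: times_divide_eq_left)
  also have "\<dots> = (\<Prod>u<n. if u = v then (1 + t v) / 2 * \<phi> 1 + (1 - t v) / 2 * \<phi> (-1) else 1)"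
    by (subst sum_prod_Conf[of "\<lambda>u s. (1 + t u * s) / 2 * (if u = v then \<phi> s else 1)"])
      (intro prod.cong refl, simp flip: add_divide_distrib)
  also have "\<dots> = (1 + t v) / 2 * \<phi> 1 + (1 - t v) / 2 * \<phi> (-1)"
    using assms by simp
  finally show ?thesis .
qed

lemma product_weight_pair:
  assumes "v < n" "w < n" "v \<noteq> w"
  shows "(\<Sum>\<sigma>\<in>Conf n. product_weight n t \<sigma> * (\<sigma> v * \<sigma> w)) = t v * t w"
proof -
  have "(\<Sum>\<sigma>\<in>Conf n. product_weight n t \<sigma> * (\<sigma> v * \<sigma> w))
      = (\<Sum>\<sigma>\<in>Conf n. \<Prod>u<n. (1 + t u * \<sigma> u) / 2 *
          ((if u = v then \<sigma> u else 1) * (if u = w then \<sigma> u else 1)))"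
    using assms by (simp add: product_weight_def prod.distrib del: times_divide_eq_left)
  also have "\<dots> = (\<Prod>u<n. (if u = v then t u else 1) * (if u = w then t u else 1))"
    by (subst sum_prod_Conf[of "\<lambda>u s. (1 + t u * s) / 2 *
          ((if u = v then s else 1) * (if u = w then s else 1))"])
      (use assms in \<open>auto intro!: prod.cong simp: field_simps\<close>)
  also have "\<dots> = t v * t w"
    using assms by (simp add: prod.distrib)
  finally show ?thesis .
qed

text \<open>The right side minus the left has derivative \<open>y^3 / (1 + y)\<close>, which has the
  sign of \<open>y\<close>, so the difference is minimal at 0, where it vanishes.\<close>

lemma ln_one_plus_le_cubic:
  assumes "-1 < (x::real)"
  shows "ln (1 + x) \<le> x - x^2/2 + x^3/3"
proof -
  define f where "f y = y - y^2/2 + y^3/3 - ln (1 + y)" for y :: real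
  have deriv: "(f has_real_derivative y^3 / (1 + y)) (at y)" if "-1 < y" for y
    unfolding f_def using that
    by (auto intro!: derivative_eq_intros simp: field_simps power2_eq_square power3_eq_cube)
  have "f 0 \<le> f x"
  proof (cases "0 \<le> x")
    case True
    then show ?thesis
      by (intro DERIV_nonneg_imp_nondecreasing[of 0 x f]) (auto intro!: exI deriv)
  next
    case False
    show ?thesis
    proof (rule DERIV_nonpos_imp_nonincreasing[of x 0 f])
      fix y assume y: "x \<le> y" "y \<le> 0"
      have "y^3 \<le> 0" using y by (simp add: power_le_zero_eq)
      then show "\<exists>d. (f has_real_derivative d) (at y) \<and> d \<le> 0"
        using deriv[of y] y assms by (intro exI[of _ "y^3/(1+y)"]) (auto simp: divide_nonpos_pos)
    qed (use False in auto)
  qed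
  then show ?thesis unfolding f_def by simp
qed

text \<open>Weighting the cubic bounds at \<open>t\<close> and \<open>-t\<close> by
  \<open>(1 + t) / 2\<close> and \<open>(1 - t) / 2\<close> keeps their even part
  \<open>- t^2/2\<close> and multiplies their odd part \<open>t + t^3/3\<close> by \<open>t\<close>.
  Hence the quadratic coefficient is the exact one and the error is quartic.\<close>

lemma neg_binary_entropy_le:
  assumes "\<bar>t\<bar> < (1::real)"
  shows "(1 + t) / 2 * ln ((1 + t) / 2) + (1 - t) / 2 * ln ((1 - t) / 2) \<le> - ln 2 + t^2/2 + t^4/3"
proof -
  have "(1 + t) / 2 * ln ((1 + t) / 2) + (1 - t) / 2 * ln ((1 - t) / 2)
      = (1 + t) / 2 * ln (1 + t) + (1 - t) / 2 * ln (1 - t) - ln 2"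
  proof -
    have "0 < 1 + t" "0 < 1 - t" using assms by auto
    then show ?thesis by (simp add: ln_div) (simp add: field_simps)
  qed
  also have "\<dots> \<le> (1 + t) / 2 * (t - t^2/2 + t^3/3) + (1 - t) / 2 * (- t - t^2/2 - t^3/3) - ln 2"
    using ln_one_plus_le_cubic[of t] ln_one_plus_le_cubic[of "-t"] assms
    by (intro diff_right_mono add_mono mult_left_mono) auto
  also have "\<dots> = - ln 2 + t^2/2 + t^4/3"
    by (simp add: field_simps power2_eq_square power3_eq_cube power4_eq_xxxx)
  finally show ?thesis .
qed

text \<open>Gibbs' variational principle for a product measure with means \<open>t\<close>: the tangent
  inequality \<open>exp y \<ge> exp m * (1 + y - m)\<close> averaged over the measure.\<close>

lemma sum_exp_ge_product_weight:
  fixes H :: "(nat \<Rightarrow> real) \<Rightarrow> real"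
  assumes t: "\<And>v. v < n \<Longrightarrow> \<bar>t v\<bar> < 1"
  shows "(\<Sum>\<sigma>\<in>Conf n. exp (H \<sigma>)) \<ge>
    exp ((\<Sum>\<sigma>\<in>Conf n. product_weight n t \<sigma> * H \<sigma>) + (\<Sum>v<n. ln 2 - (t v)^2/2 - (t v)^4/3))"
proof -
  define q where "q = product_weight n t"
  have pos: "0 < 1 + t v * \<sigma> v" if "\<sigma> \<in> Conf n" "v < n" for \<sigma> v
    using t[OF that(2)] Conf_spin[OF that] by auto
  then have nonzero: "(1 + t v * \<sigma> v) / 2 \<noteq> 0" if "\<sigma> \<in> Conf n" "v \<in> {..<n}" for \<sigma> v
    using that by (metis divide_pos_pos lessThan_iff less_irrefl zero_less_numeral)
  have q_pos: "0 < q \<sigma>" if "\<sigma> \<in> Conf n" for \<sigma>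
    unfolding q_def product_weight_def using pos[OF that] by (intro prod_pos) auto
  have ln_q: "ln (q \<sigma>) = (\<Sum>v<n. ln ((1 + t v * \<sigma> v) / 2))" if "\<sigma> \<in> Conf n" for \<sigma>
    unfolding q_def product_weight_def using nonzero[OF that] by (intro ln_prod) auto
  \<comment> \<open>The variational functional: mean energy term plus entropy of
    \<open>q\<close>.\<close>
  define m where "m = (\<Sum>\<sigma>\<in>Conf n. q \<sigma> * (H \<sigma> - ln (q \<sigma>)))"
  have q_sum: "(\<Sum>\<sigma>\<in>Conf n. q \<sigma>) = 1" unfolding q_def by (rule product_weight_sum)
  have "(\<Sum>\<sigma>\<in>Conf n. q \<sigma> * ln (q \<sigma>)) = (\<Sum>\<sigma>\<in>Conf n. \<Sum>v<n. q \<sigma> * ln ((1 + t v * \<sigma> v) / 2))"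
    by (intro sum.cong) (simp_all add: ln_q sum_distrib_left)
  also have "\<dots> = (\<Sum>v<n. \<Sum>\<sigma>\<in>Conf n. q \<sigma> * ln ((1 + t v * \<sigma> v) / 2))"
    by (rule sum.swap)
  also have "\<dots> \<le> (\<Sum>v<n. - ln 2 + (t v)^2/2 + (t v)^4/3)"
  proof (rule sum_mono)
    fix v assume "v \<in> {..<n}"
    then show "(\<Sum>\<sigma>\<in>Conf n. q \<sigma> * ln ((1 + t v * \<sigma> v) / 2)) \<le> - ln 2 + (t v)^2/2 + (t v)^4/3"
      unfolding q_def
      using product_weight_single[of v n t "\<lambda>s. ln ((1 + t v * s) / 2)"] neg_binary_entropy_le[OF t]
      by simp
  qed
  also have "\<dots> = - (\<Sum>v<n. ln 2 - (t v)^2/2 - (t v)^4/3)"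
    unfolding sum_negf[symmetric] by (intro sum.cong) auto
  finally have "(\<Sum>\<sigma>\<in>Conf n. q \<sigma> * H \<sigma>) + (\<Sum>v<n. ln 2 - (t v)^2/2 - (t v)^4/3) \<le> m"
    unfolding m_def by (simp add: right_diff_distrib sum_subtractf)
  then have "exp ((\<Sum>\<sigma>\<in>Conf n. q \<sigma> * H \<sigma>) + (\<Sum>v<n. ln 2 - (t v)^2/2 - (t v)^4/3)) \<le> exp m"
    by simp
  \<comment> \<open>\<open>m\<close> is the \<open>q\<close>-mean of
    \<open>H \<sigma> - ln (q \<sigma>)\<close>, so the linear part of the tangent averages to
    0.\<close>
  also have "exp m = (\<Sum>\<sigma>\<in>Conf n. q \<sigma> * (exp m * (1 + (H \<sigma> - ln (q \<sigma>) - m))))"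
  proof -
    have "(\<Sum>\<sigma>\<in>Conf n. q \<sigma> * (exp m * (1 + (H \<sigma> - ln (q \<sigma>) - m))))
        = (\<Sum>\<sigma>\<in>Conf n. exp m * (q \<sigma> * (H \<sigma> - ln (q \<sigma>))) + exp m * (1 - m) * q \<sigma>)"
      by (intro sum.cong) (auto simp: algebra_simps)
    also have "\<dots> = exp m * m + exp m * (1 - m)"
      unfolding sum.distrib by (simp add: m_def q_sum flip: sum_distrib_left)
    finally show ?thesis by (simp add: algebra_simps)
  qed
  also have "\<dots> \<le> (\<Sum>\<sigma>\<in>Conf n. exp (H \<sigma>))"
  proof (rule sum_mono)
    fix \<sigma> assume \<sigma>: "\<sigma> \<in> Conf n"
    have "q \<sigma> * (exp m * (1 + (H \<sigma> - ln (q \<sigma>) - m))) \<le> q \<sigma> * (exp m * exp (H \<sigma> - ln (q \<sigma>) - m))"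
      using q_pos[OF \<sigma>] by (intro mult_left_mono exp_ge_add_one_self) auto
    also have "\<dots> = exp (H \<sigma>)"
      using q_pos[OF \<sigma>] by (simp flip: exp_add) (simp add: exp_diff)
    finally show "q \<sigma> * (exp m * (1 + (H \<sigma> - ln (q \<sigma>) - m))) \<le> exp (H \<sigma>)" .
  qed
  finally show ?thesis unfolding q_def .
qed

subsection \<open>The Glauber dynamics\<close>

definition block_mag :: "(nat \<Rightarrow> 'i) \<Rightarrow> nat \<Rightarrow> (nat \<Rightarrow> real) \<Rightarrow> 'i \<Rightarrow> real" where
  "block_mag g n \<sigma> i = (\<Sum>v | v < n \<and> g v = i. \<sigma> v)"

lemma sum_blocks:
  fixes g :: "nat \<Rightarrow> 'i::finite"
  shows "(\<Sum>v<n. f (g v) * \<sigma> v) = (\<Sum>i\<in>UNIV. f i * block_mag g n \<sigma> i)"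
proof -
  have "(\<Sum>v<n. f (g v) * \<sigma> v) = (\<Sum>i\<in>UNIV. \<Sum>v\<in>{v. v \<in> {..<n} \<and> g v = i}. f (g v) * \<sigma> v)"
    by (rule sum.group[symmetric]) auto
  also have "\<dots> = (\<Sum>i\<in>UNIV. f i * block_mag g n \<sigma> i)"
    unfolding block_mag_def sum_distrib_left by (intro sum.cong) auto
  finally show ?thesis .
qed

lemma sum_block_mag:
  fixes g :: "nat \<Rightarrow> 'i::finite"
  shows "(\<Sum>i\<in>UNIV. block_mag g n \<sigma> i) = (\<Sum>v<n. \<sigma> v)"
  using sum_blocks[of "\<lambda>_. 1" g \<sigma> n] by simp

text \<open>\<open>energy\<close> counts each unordered pair once, whereas summing the local fields
  counts both orders.\<close>

lemma energy_symmetric: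
  assumes "\<forall>i j. k i j = k j i"
  shows "2 * energy k g n \<sigma> = (\<Sum>v<n. \<sigma> v * local_field k g n \<sigma> v)"
proof -
  define f where "f v w = Kint k g n v w * \<sigma> v * \<sigma> w" for v w
  have f_sym: "f v w = f w v" for v w
    unfolding f_def Kint_def using assms by simp
  have e: "energy k g n \<sigma> = (\<Sum>v<n. \<Sum>w | w \<in> {..<n} \<and> v < w. f v w)"
    unfolding energy_def f_def by (intro sum.cong) auto
  also have "\<dots> = (\<Sum>v<n. \<Sum>w | w \<in> {..<n} \<and> w < v. f v w)"
    by (subst sum.swap_restrict) (auto intro!: sum.cong simp: f_sym)
  finally have e': "energy k g n \<sigma> = (\<Sum>v<n. \<Sum>w | w \<in> {..<n} \<and> w < v. f v w)" .
  have "2 * energy k g n \<sigma>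
      = (\<Sum>v<n. (\<Sum>w | w \<in> {..<n} \<and> v < w. f v w) + (\<Sum>w | w \<in> {..<n} \<and> w < v. f v w))"
    using e e' by (simp add: sum.distrib)
  also have "\<dots> = (\<Sum>v<n. \<Sum>w\<in>{..<n} - {v}. f v w)"
    by (intro sum.cong refl, subst sum.union_disjoint[symmetric]) (auto intro!: sum.cong)
  also have "\<dots> = (\<Sum>v<n. \<sigma> v * local_field k g n \<sigma> v)"
    unfolding local_field_def f_def by (simp add: sum_distrib_left mult_ac)
  finally show ?thesis .
qed

text \<open>Adding the diagonal terms \<open>v = w\<close> makes the double sum depend on the block
  magnetizations only; they are then subtracted. The squares \<open>(\<sigma> v)\<^sup>2\<close> are
  kept because the identity is also applied to real vectors of means, not only to spins.\<close>

lemma energy_block_mag: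
  fixes g :: "nat \<Rightarrow> 'i::finite"
  assumes sym: "\<forall>i j. k i j = k j i" and n: "0 < n"
  shows "2 * real n * energy k g n \<sigma> =
    (\<Sum>i\<in>UNIV. \<Sum>j\<in>UNIV. k i j * (block_mag g n \<sigma> i * block_mag g n \<sigma> j))
    - (\<Sum>v<n. k (g v) (g v) * (\<sigma> v)\<^sup>2)"
proof -
  have field: "real n * local_field k g n \<sigma> v
      = (\<Sum>j\<in>UNIV. k (g v) j * block_mag g n \<sigma> j) - k (g v) (g v) * \<sigma> v" if "v < n" for v
  proof -
    have "real n * local_field k g n \<sigma> v = (\<Sum>w\<in>{..<n} - {v}. k (g v) (g w) * \<sigma> w)"
      unfolding local_field_def Kint_def using n by (simp add: sum_distrib_left)
    also have "\<dots> = (\<Sum>w<n. k (g v) (g w) * \<sigma> w) - k (g v) (g v) * \<sigma> v"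
      using that by (simp add: sum_diff1)
    finally show ?thesis by (simp add: sum_blocks)
  qed
  have "2 * real n * energy k g n \<sigma> = (\<Sum>v<n. \<sigma> v * (real n * local_field k g n \<sigma> v))"
    using energy_symmetric[OF sym, of g n \<sigma>] by (simp add: sum_distrib_left mult_ac)
  also have "\<dots> = (\<Sum>v<n. (\<Sum>j\<in>UNIV. k (g v) j * block_mag g n \<sigma> j) * \<sigma> v - k (g v) (g v) * (\<sigma> v)\<^sup>2)"
    by (intro sum.cong) (auto simp: field algebra_simps power2_eq_square)
  also have "\<dots> = (\<Sum>i\<in>UNIV. (\<Sum>j\<in>UNIV. k i j * block_mag g n \<sigma> j) * block_mag g n \<sigma> i)
      - (\<Sum>v<n. k (g v) (g v) * (\<sigma> v)\<^sup>2)"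
    by (simp add: sum_subtractf sum_blocks[of "\<lambda>i. \<Sum>j\<in>UNIV. k i j * block_mag g n \<sigma> j"])
  also have "(\<Sum>i\<in>UNIV. (\<Sum>j\<in>UNIV. k i j * block_mag g n \<sigma> j) * block_mag g n \<sigma> i)
      = (\<Sum>i\<in>UNIV. \<Sum>j\<in>UNIV. k i j * (block_mag g n \<sigma> i * block_mag g n \<sigma> j))"
    unfolding sum_distrib_right by (intro sum.cong refl) simp
  finally show ?thesis .
qed

section \<open>Single-site updates and detailed balance\<close>

lemma local_field_cong:
  assumes "\<forall>u. u \<noteq> v \<longrightarrow> \<tau> u = \<sigma> u"
  shows "local_field k g n \<tau> v = local_field k g n \<sigma> v"
  unfolding local_field_def using assms by (intro sum.cong) auto

text \<open>Twice the energy is the sum of spin times local field. Changing spin \<open>v\<close>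
  alters this sum once through the term of \<open>v\<close>, whose field is unaffected, and once, by
  the same amount, through the fields felt by the other vertices.\<close>

lemma energy_flip:
  assumes sym: "\<forall>i j. k i j = k j i" and v: "v < n" and eq: "\<forall>u. u \<noteq> v \<longrightarrow> \<tau> u = \<sigma> u"
  shows "energy k g n \<tau> - energy k g n \<sigma> = (\<tau> v - \<sigma> v) * local_field k g n \<sigma> v"
proof -
  define S where "S = local_field k g n"
  have K_sym: "Kint k g n u w = Kint k g n w u" for u w
    unfolding Kint_def using sym by simp
  have diff: "S \<tau> u - S \<sigma> u = Kint k g n u v * (\<tau> v - \<sigma> v)" if "u < n" "u \<noteq> v" for u
  proof -
    have "S \<tau> u - S \<sigma> u = (\<Sum>w\<in>{..<n} - {u}. Kint k g n u w * (\<tau> w - \<sigma> w))"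
      unfolding S_def local_field_def by (simp add: right_diff_distrib sum_subtractf)
    also have "\<dots> = (\<Sum>w\<in>{..<n} - {u}. if w = v then Kint k g n u v * (\<tau> v - \<sigma> v) else 0)"
      using eq by (intro sum.cong) auto
    also have "\<dots> = Kint k g n u v * (\<tau> v - \<sigma> v)"
      using v that by (simp add: sum.delta)
    finally show ?thesis .
  qed
  have "2 * (energy k g n \<tau> - energy k g n \<sigma>) = (\<Sum>u<n. \<tau> u * S \<tau> u - \<sigma> u * S \<sigma> u)"
    using energy_symmetric[OF sym, of g n] by (simp add: sum_subtractf S_def right_diff_distrib)
  also have "\<dots> = (\<tau> v * S \<tau> v - \<sigma> v * S \<sigma> v) + (\<Sum>u\<in>{..<n} - {v}. \<tau> u * S \<tau> u - \<sigma> u * S \<sigma> u)"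
    using v by (intro sum.remove) auto
  also have "(\<Sum>u\<in>{..<n} - {v}. \<tau> u * S \<tau> u - \<sigma> u * S \<sigma> u)
      = (\<Sum>u\<in>{..<n} - {v}. (\<tau> v - \<sigma> v) * (Kint k g n v u * \<sigma> u))"
  proof (rule sum.cong[OF refl])
    fix u assume "u \<in> {..<n} - {v}"
    then have "\<tau> u * S \<tau> u - \<sigma> u * S \<sigma> u = \<sigma> u * (S \<tau> u - S \<sigma> u)" "u < n" "u \<noteq> v"
      using eq by (auto simp: right_diff_distrib)
    then show "\<tau> u * S \<tau> u - \<sigma> u * S \<sigma> u = (\<tau> v - \<sigma> v) * (Kint k g n v u * \<sigma> u)"
      using diff K_sym[of u v] by simp
  qed
  also have "\<dots> = (\<tau> v - \<sigma> v) * S \<sigma> v"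
    unfolding S_def local_field_def by (simp add: sum_distrib_left)
  also have "S \<tau> v = S \<sigma> v"
    unfolding S_def using eq by (rule local_field_cong)
  finally show ?thesis unfolding S_def by (simp add: algebra_simps)
qed

lemma energy_uminus: "energy k g n (\<lambda>v. - \<sigma> v) = energy k g n \<sigma>"
  unfolding energy_def by simp

abbreviation partition_fn :: "real \<Rightarrow> ('i \<Rightarrow> 'i \<Rightarrow> real) \<Rightarrow> (nat \<Rightarrow> 'i) \<Rightarrow> nat \<Rightarrow> real" where
  "partition_fn \<beta> k g n \<equiv> (\<Sum>\<sigma>\<in>Conf n. exp (\<beta> * energy k g n \<sigma>))"

lemma partition_fn_pos: "0 < partition_fn \<beta> k g n"
  using finite_Conf Conf_nonempty by (intro sum_pos) auto

lemma gibbs_nonneg: "0 \<le> gibbs \<beta> k g n \<sigma>"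
  unfolding gibbs_def using partition_fn_pos[of \<beta> k g n] by simp

lemma gibbs_sum: "(\<Sum>\<sigma>\<in>Conf n. gibbs \<beta> k g n \<sigma>) = 1"
  unfolding gibbs_def using partition_fn_pos[of \<beta> k g n] by (simp flip: sum_divide_distrib)

lemma heat_bath_pos:
  assumes "s = 1 \<or> s = -(1::real)"
  shows "0 < (1 + s * tanh x) / 2"
  using assms tanh_real_lt_1[of x] tanh_real_gt_neg1[of x] by auto

text \<open>Rewrites the update probability as a Boltzmann factor with normaliser
  \<open>cosh x\<close>, which does not depend on the new spin and so cancels in detailed
  balance.\<close>

lemma heat_bath_eq:
  assumes "s = 1 \<or> s = -(1::real)"
  shows "1 + s * tanh x = exp (s * x) / cosh x"
proof -
  have "cosh x \<noteq> 0" using cosh_real_pos[of x] by simp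
  then show ?thesis
    using assms by (auto simp: tanh_def cosh_def sinh_def field_simps)
qed

lemma glauber_nonneg:
  assumes "\<tau> \<in> Conf n"
  shows "0 \<le> glauber \<beta> k g n \<sigma> \<tau>"
  unfolding glauber_def
proof (intro mult_nonneg_nonneg sum_nonneg)
  fix v assume "v \<in> {..<n}"
  then show "0 \<le> (if \<forall>u. u \<noteq> v \<longrightarrow> \<tau> u = \<sigma> u
      then (1 + \<tau> v * tanh (\<beta> * local_field k g n \<sigma> v)) / 2 else 0)"
    using heat_bath_pos[OF Conf_spin[OF assms], of v "\<beta> * local_field k g n \<sigma> v"] by auto
qed simp

lemma glauber_pos:
  assumes "\<tau> \<in> Conf n" "v < n" "\<forall>u. u \<noteq> v \<longrightarrow> \<tau> u = \<sigma> u"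
  shows "0 < glauber \<beta> k g n \<sigma> \<tau>"
  unfolding glauber_def
proof (intro mult_pos_pos sum_pos2[of _ v])
  show "0 < (if \<forall>u. u \<noteq> v \<longrightarrow> \<tau> u = \<sigma> u
      then (1 + \<tau> v * tanh (\<beta> * local_field k g n \<sigma> v)) / 2 else 0)"
    using assms heat_bath_pos[OF Conf_spin[OF assms(1,2)], of "\<beta> * local_field k g n \<sigma> v"] by auto
next
  fix v assume "v \<in> {..<n}"
  then show "0 \<le> (if \<forall>u. u \<noteq> v \<longrightarrow> \<tau> u = \<sigma> u
      then (1 + \<tau> v * tanh (\<beta> * local_field k g n \<sigma> v)) / 2 else 0)"
    using heat_bath_pos[OF Conf_spin[OF assms(1)], of v "\<beta> * local_field k g n \<sigma> v"] by auto
qed (use assms in auto)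

lemma glauber_nonzeroE:
  assumes "glauber \<beta> k g n \<sigma> \<tau> \<noteq> 0"
  obtains v where "v < n" "\<forall>u. u \<noteq> v \<longrightarrow> \<tau> u = \<sigma> u"
proof -
  have "\<exists>v<n. \<forall>u. u \<noteq> v \<longrightarrow> \<tau> u = \<sigma> u"
  proof (rule ccontr)
    assume none: "\<not> ?thesis"
    have "glauber \<beta> k g n \<sigma> \<tau> = 1 / real n * (\<Sum>v<n. 0)"
      unfolding glauber_def using none by (intro arg_cong2[where f = "(*)"] sum.cong refl if_not_P) blast
    then show False using assms by simp
  qed
  then show thesis using that by blast
qed

lemma glauber_row:
  assumes \<sigma>: "\<sigma> \<in> Conf n" and n: "0 < n"
  shows "(\<Sum>\<tau>\<in>Conf n. glauber \<beta> k g n \<sigma> \<tau>) = 1"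
proof -
  have "(\<Sum>\<tau>\<in>Conf n. if \<forall>u. u \<noteq> v \<longrightarrow> \<tau> u = \<sigma> u
      then (1 + \<tau> v * tanh (\<beta> * local_field k g n \<sigma> v)) / 2 else 0) = 1" (is "?s = 1") if v: "v < n" for v
  proof -
    \<comment> \<open>Once the vertex is chosen, only two configurations are reachable, and their
      heat-bath probabilities add up to 1.\<close>
    have set_eq: "{\<tau> \<in> Conf n. \<forall>u. u \<noteq> v \<longrightarrow> \<tau> u = \<sigma> u} = {\<sigma>(v := 1), \<sigma>(v := -1)}"
    proof (intro equalityI subsetI)
      fix \<tau> assume "\<tau> \<in> {\<tau> \<in> Conf n. \<forall>u. u \<noteq> v \<longrightarrow> \<tau> u = \<sigma> u}"
      then have "\<tau> = \<sigma>(v := \<tau> v)" "\<tau> v = 1 \<or> \<tau> v = -1"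
        using Conf_spin v by auto
      then show "\<tau> \<in> {\<sigma>(v := 1), \<sigma>(v := -1)}" by (metis insertCI)
    next
      fix \<tau> assume "\<tau> \<in> {\<sigma>(v := 1), \<sigma>(v := -1)}"
      then show "\<tau> \<in> {\<tau> \<in> Conf n. \<forall>u. u \<noteq> v \<longrightarrow> \<tau> u = \<sigma> u}"
        using \<sigma> v unfolding Conf_def by (elim insertE) simp_all
    qed
    have ne: "\<sigma>(v := 1) \<noteq> \<sigma>(v := -1)"
      by (auto dest: fun_cong[where x = v])
    have "?s = (\<Sum>\<tau>\<in>{\<sigma>(v := 1), \<sigma>(v := -1)}. (1 + \<tau> v * tanh (\<beta> * local_field k g n \<sigma> v)) / 2)"
      unfolding set_eq[symmetric] using finite_Conf by (rule sum.inter_filter[symmetric])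
    also have "\<dots> = 1" using ne by (simp add: field_simps)
    finally show ?thesis .
  qed
  then have "(\<Sum>v<n. \<Sum>\<tau>\<in>Conf n. if \<forall>u. u \<noteq> v \<longrightarrow> \<tau> u = \<sigma> u
      then (1 + \<tau> v * tanh (\<beta> * local_field k g n \<sigma> v)) / 2 else 0) = real n"
    by simp
  then show ?thesis
    unfolding glauber_def sum_distrib_left[symmetric] using n by (subst sum.swap) simp
qed

text \<open>Detailed balance holds separately for each chosen vertex \<open>v\<close>:
  configurations agreeing off \<open>v\<close> have the same local field at \<open>v\<close>, and
  \<open>energy_flip\<close> matches the two Boltzmann factors.\<close>

lemma glauber_reversible:
  assumes sym: "\<forall>i j. k i j = k j i" and \<sigma>: "\<sigma> \<in> Conf n" and \<tau>: "\<tau> \<in> Conf n"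
  shows "gibbs \<beta> k g n \<sigma> * glauber \<beta> k g n \<sigma> \<tau> = gibbs \<beta> k g n \<tau> * glauber \<beta> k g n \<tau> \<sigma>"
proof -
  have term_eq: "exp (\<beta> * energy k g n \<sigma>) * (1 + \<tau> v * tanh (\<beta> * local_field k g n \<sigma> v))
      = exp (\<beta> * energy k g n \<tau>) * (1 + \<sigma> v * tanh (\<beta> * local_field k g n \<tau> v))"
    if v: "v < n" and eq: "\<forall>u. u \<noteq> v \<longrightarrow> \<tau> u = \<sigma> u" for v
  proof -
    define x where "x = \<beta> * local_field k g n \<sigma> v"
    have x': "\<beta> * local_field k g n \<tau> v = x"
      unfolding x_def using local_field_cong[OF eq, of k g n] by simp
    have "\<beta> * energy k g n \<sigma> + \<tau> v * x = \<beta> * energy k g n \<tau> + \<sigma> v * x"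
    proof -
      have "\<beta> * (energy k g n \<tau> - energy k g n \<sigma>) = \<tau> v * x - \<sigma> v * x"
        unfolding energy_flip[OF sym v eq] x_def by (simp add: algebra_simps)
      then show ?thesis by (simp add: algebra_simps)
    qed
    then have "exp (\<beta> * energy k g n \<sigma>) * exp (\<tau> v * x) = exp (\<beta> * energy k g n \<tau>) * exp (\<sigma> v * x)"
      by (simp flip: exp_add)
    then show ?thesis
      unfolding x' x_def[symmetric]
      using heat_bath_eq[OF Conf_spin[OF \<sigma> v], of x] heat_bath_eq[OF Conf_spin[OF \<tau> v], of x] by simp
  qed
  have "exp (\<beta> * energy k g n \<sigma>) * glauber \<beta> k g n \<sigma> \<tau> = exp (\<beta> * energy k g n \<tau>) * glauber \<beta> k g n \<tau> \<sigma>"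
  proof -
    have "(\<Sum>v<n. exp (\<beta> * energy k g n \<sigma>) * (if \<forall>u. u \<noteq> v \<longrightarrow> \<tau> u = \<sigma> u
        then (1 + \<tau> v * tanh (\<beta> * local_field k g n \<sigma> v)) / 2 else 0))
      = (\<Sum>v<n. exp (\<beta> * energy k g n \<tau>) * (if \<forall>u. u \<noteq> v \<longrightarrow> \<sigma> u = \<tau> u
        then (1 + \<sigma> v * tanh (\<beta> * local_field k g n \<tau> v)) / 2 else 0))"
    proof (rule sum.cong[OF refl])
      fix v assume "v \<in> {..<n}"
      then have v: "v < n" by simp
      show "exp (\<beta> * energy k g n \<sigma>) * (if \<forall>u. u \<noteq> v \<longrightarrow> \<tau> u = \<sigma> u
          then (1 + \<tau> v * tanh (\<beta> * local_field k g n \<sigma> v)) / 2 else 0)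
        = exp (\<beta> * energy k g n \<tau>) * (if \<forall>u. u \<noteq> v \<longrightarrow> \<sigma> u = \<tau> u
          then (1 + \<sigma> v * tanh (\<beta> * local_field k g n \<tau> v)) / 2 else 0)"
      proof -
        have swap: "(\<forall>u. u \<noteq> v \<longrightarrow> \<sigma> u = \<tau> u) \<longleftrightarrow> (\<forall>u. u \<noteq> v \<longrightarrow> \<tau> u = \<sigma> u)" by metis
        show ?thesis
        proof (cases "\<forall>u. u \<noteq> v \<longrightarrow> \<tau> u = \<sigma> u")
          case True
          show ?thesis
            unfolding swap if_P[OF True] using term_eq[OF v True] by simp
        next
          case False
          show ?thesis unfolding swap if_not_P[OF False] by simp
        qed
      qed
    qed
    then show ?thesis
      unfolding glauber_def sum_distrib_left[symmetric] by simp
  qed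
  then show ?thesis unfolding gibbs_def by simp
qed

lemma glauber_chain:
  assumes sym: "\<forall>i j. k i j = k j i" and n: "0 < n"
  shows "finite_chain (Conf n) (glauber \<beta> k g n) (gibbs \<beta> k g n)"
proof
  fix \<tau> assume \<tau>: "\<tau> \<in> Conf n"
  have "(\<Sum>\<sigma>\<in>Conf n. gibbs \<beta> k g n \<sigma> * glauber \<beta> k g n \<sigma> \<tau>)
      = (\<Sum>\<sigma>\<in>Conf n. gibbs \<beta> k g n \<tau> * glauber \<beta> k g n \<tau> \<sigma>)"
    using glauber_reversible[OF sym _ \<tau>] by (intro sum.cong) auto
  also have "\<dots> = gibbs \<beta> k g n \<tau>"
    using glauber_row[OF \<tau> n, of \<beta> k g] by (simp flip: sum_distrib_left)
  finally show "(\<Sum>\<sigma>\<in>Conf n. gibbs \<beta> k g n \<sigma> * glauber \<beta> k g n \<sigma> \<tau>) = gibbs \<beta> k g n \<tau>" .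
qed (use n in \<open>auto simp: finite_Conf glauber_nonneg glauber_row gibbs_nonneg gibbs_sum\<close>)

section \<open>Convergence to equilibrium and the mixing time\<close>

lemma glauber_pow_eq: "glauber_pow \<beta> k g n t = kernel_pow (Conf n) (glauber \<beta> k g n) t"
  by (induction t) (auto simp: fun_eq_iff)

text \<open>Updating vertices \<open>0, ..., j - 1\<close> in turn to their values in
  \<open>\<tau>\<close> is a path of positive probability. With \<open>j = n\<close>, all
  \<open>n\<close>-step transition probabilities are positive.\<close>

lemma glauber_pow_pos:
  assumes n: "0 < n" and sym: "\<forall>i j. k i j = k j i"
    and "j \<le> n" "\<sigma> \<in> Conf n" "\<tau> \<in> Conf n" "\<forall>v\<ge>j. \<tau> v = \<sigma> v"
  shows "0 < kernel_pow (Conf n) (glauber \<beta> k g n) j \<sigma> \<tau>"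
  using assms(3-)
proof (induction j arbitrary: \<tau>)
  case 0
  then have "\<sigma> = \<tau>" by auto
  then show ?case by simp
next
  case (Suc j)
  interpret finite_chain "Conf n" "glauber \<beta> k g n" "gibbs \<beta> k g n"
    using glauber_chain[OF sym n] .
  \<comment> \<open>The state before vertex \<open>j\<close> is updated. It may equal
    \<open>\<tau>\<close>, which is harmless because an update can leave the spin unchanged.\<close>
  let ?\<rho> = "\<tau>(j := \<sigma> j)"
  have \<rho>: "?\<rho> \<in> Conf n"
    using Suc.prems unfolding Conf_def by (simp split: if_splits)
  have "0 < pow j \<sigma> ?\<rho>"
    using Suc.prems by (intro Suc.IH[OF _ _ \<rho>]) auto
  moreover have "0 < glauber \<beta> k g n ?\<rho> \<tau>"
    using Suc.prems by (intro glauber_pos[of \<tau> n j]) auto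
  ultimately have "0 < (\<Sum>\<rho>\<in>Conf n. pow j \<sigma> \<rho> * glauber \<beta> k g n \<rho> \<tau>)"
    using Suc.prems
    by (intro sum_pos2[OF finite_Conf \<rho>] mult_pos_pos mult_nonneg_nonneg pow_nonneg P_nonneg)
  then show ?case by simp
qed

lemma dist_mix_mixing_time_le:
  assumes sym: "\<forall>i j. k i j = k j i" and n: "0 < n"
  shows "dist_mix \<beta> k g n (mixing_time \<beta> k g n) \<le> 1/4"
proof -
  interpret finite_chain "Conf n" "glauber \<beta> k g n" "gibbs \<beta> k g n"
    using glauber_chain[OF sym n] .
  have "0 < pow n \<sigma> \<tau>" if "\<sigma> \<in> Conf n" "\<tau> \<in> Conf n" for \<sigma> \<tau>
    using that by (intro glauber_pow_pos n sym) (auto simp: Conf_def)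
  then obtain t where "\<forall>\<sigma>\<in>Conf n. tv t \<sigma> \<le> 1/4"
    using tv_eventually_le[of n "1/4"] by auto
  then have "dist_mix \<beta> k g n t \<le> 1/4"
    unfolding dist_mix_def tv_def glauber_pow_eq
    using finite_Conf Conf_nonempty by (intro Max.boundedI) auto
  then show ?thesis unfolding mixing_time_def by (rule LeastI)
qed

text \<open>A single spin flip changes the total magnetization by at most 2, so only configurations with
  total magnetization at most 2 can leave the positive half-space in one step.\<close>

lemma mixing_time_bottleneck:
  assumes sym: "\<forall>i j. k i j = k j i" and n: "0 < n"
    and b: "b = (\<Sum>\<sigma> | \<sigma> \<in> Conf n \<and> \<bar>\<Sum>v<n. \<sigma> v\<bar> \<le> 2. gibbs \<beta> k g n \<sigma>)"
  shows "(1 - b) / 8 \<le> real (mixing_time \<beta> k g n) * b"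
proof -
  interpret finite_chain "Conf n" "glauber \<beta> k g n" "gibbs \<beta> k g n"
    using glauber_chain[OF sym n] .
  define m where "m \<sigma> = (\<Sum>v<n. \<sigma> v)" for \<sigma> :: "nat \<Rightarrow> real"
  define t where "t = mixing_time \<beta> k g n"
  define mass where "mass X = (\<Sum>\<sigma>\<in>X. gibbs \<beta> k g n \<sigma>)" for X
  define pos where "pos = {\<sigma> \<in> Conf n. 0 < m \<sigma>}"
  define neg where "neg = {\<sigma> \<in> Conf n. m \<sigma> < 0}"
  define zero where "zero = {\<sigma> \<in> Conf n. m \<sigma> = 0}"
  define B where "B = {\<sigma> \<in> Conf n. \<bar>m \<sigma>\<bar> \<le> 2}"
  have fin: "finite pos" "finite neg" "finite zero" "finite B"
    unfolding pos_def neg_def zero_def B_def using finite_Conf by auto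
  have b_eq: "b = mass B" unfolding b mass_def B_def m_def by simp
  have rest: "Conf n - pos = neg \<union> zero" unfolding pos_def neg_def zero_def by auto
  have mass_rest: "mass (Conf n - pos) = mass neg + mass zero"
    unfolding rest mass_def using fin by (intro sum.union_disjoint) (auto simp: neg_def zero_def)
  have mass_pos: "mass pos + mass (Conf n - pos) = 1"
    unfolding mass_def using gibbs_sum[of \<beta> k g n] sum.subset_diff[of pos "Conf n" "gibbs \<beta> k g n"] finite_Conf
    by (simp add: pos_def)
  have mass_neg: "mass neg = mass pos"
    unfolding mass_def
    by (rule sum.reindex_bij_witness[of _ "\<lambda>\<sigma> v. - \<sigma> v" "\<lambda>\<sigma> v. - \<sigma> v"])
      (auto simp: neg_def pos_def m_def Conf_def sum_negf gibbs_def energy_uminus)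
  have mass_zero: "0 \<le> mass zero" "mass zero \<le> mass B"
    unfolding mass_def
    by (rule sum_nonneg, rule gibbs_nonneg)
      (rule sum_mono2, auto simp: fin gibbs_nonneg, auto simp: zero_def B_def)
  have "flow pos \<le> mass B"
  proof -
    have "flow pos = (\<Sum>\<sigma>\<in>pos. gibbs \<beta> k g n \<sigma> * (\<Sum>\<tau>\<in>Conf n - pos. glauber \<beta> k g n \<sigma> \<tau>))"
      unfolding flow_def by (simp add: sum_distrib_left)
    also have "\<dots> \<le> (\<Sum>\<sigma>\<in>pos. if \<sigma> \<in> B then gibbs \<beta> k g n \<sigma> else 0)"
    proof (rule sum_mono)
      fix \<sigma> assume \<sigma>: "\<sigma> \<in> pos"
      then have \<sigma>C: "\<sigma> \<in> Conf n" by (simp add: pos_def)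
      show "gibbs \<beta> k g n \<sigma> * (\<Sum>\<tau>\<in>Conf n - pos. glauber \<beta> k g n \<sigma> \<tau>)
          \<le> (if \<sigma> \<in> B then gibbs \<beta> k g n \<sigma> else 0)"
      proof (cases "\<sigma> \<in> B")
        case True
        have "(\<Sum>\<tau>\<in>Conf n - pos. glauber \<beta> k g n \<sigma> \<tau>) \<le> (\<Sum>\<tau>\<in>Conf n. glauber \<beta> k g n \<sigma> \<tau>)"
          using finite_Conf glauber_nonneg by (intro sum_mono2) auto
        then show ?thesis
          using True P_row[OF \<sigma>C] gibbs_nonneg[of \<beta> k g n \<sigma>] by (simp add: mult_left_le)
      next
        case False
        have "glauber \<beta> k g n \<sigma> \<tau> = 0" if \<tau>: "\<tau> \<in> Conf n - pos" for \<tau>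
        proof (rule ccontr)
          assume "glauber \<beta> k g n \<sigma> \<tau> \<noteq> 0"
          then obtain v where v: "v < n" "\<forall>u. u \<noteq> v \<longrightarrow> \<tau> u = \<sigma> u" by (rule glauber_nonzeroE)
          have "m \<sigma> - m \<tau> = (\<Sum>u<n. if u = v then \<sigma> v - \<tau> v else 0)"
            unfolding m_def sum_subtractf[symmetric] using v by (intro sum.cong) auto
          also have "\<dots> = \<sigma> v - \<tau> v" using v by simp
          also have "\<dots> \<le> 2"
            using Conf_spin[OF \<sigma>C v(1)] Conf_spin[of \<tau> n v] \<tau> v(1) by auto
          finally show False
            using \<tau> \<sigma> False unfolding pos_def B_def by auto
        qed
        then show ?thesis using False by simp
      qed
    qed
    also have "\<dots> = (\<Sum>\<sigma>\<in>pos \<inter> B. gibbs \<beta> k g n \<sigma>)"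
      using fin(1) by (simp add: sum.inter_restrict)
    also have "\<dots> \<le> mass B"
      unfolding mass_def using fin gibbs_nonneg by (intro sum_mono2) auto
    finally show ?thesis .
  qed
  moreover have "mass pos / 4 \<le> real t * flow pos"
    unfolding mass_def
  proof (rule bottleneck)
    \<comment> \<open>The complement of \<open>pos\<close> contains \<open>neg\<close>, which has
      the same mass as \<open>pos\<close> by the spin-flip symmetry.\<close>
    show "1 / 2 \<le> (\<Sum>\<sigma>\<in>Conf n - pos. gibbs \<beta> k g n \<sigma>)"
      using mass_pos mass_rest mass_neg mass_zero unfolding mass_def by linarith
    show "\<forall>\<sigma>\<in>pos. tv t \<sigma> \<le> 1 / 4"
    proof
      fix \<sigma> assume "\<sigma> \<in> pos"
      then have "tv t \<sigma> \<le> dist_mix \<beta> k g n t"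
        unfolding dist_mix_def tv_def glauber_pow_eq pos_def
        using finite_Conf by (intro Max_ge) auto
      also have "\<dots> \<le> 1 / 4"
        unfolding t_def using dist_mix_mixing_time_le[OF sym n] .
      finally show "tv t \<sigma> \<le> 1 / 4" .
    qed
  qed (auto simp: pos_def)
  \<comment> \<open>By symmetry \<open>2 * mass pos = 1 - mass zero\<close>, and \<open>zero\<close>
    lies inside \<open>B\<close>.\<close>
  moreover have "(1 - mass B) / 8 \<le> mass pos / 4"
    using mass_pos mass_rest mass_neg mass_zero by argo
  moreover have "real t * flow pos \<le> real t * mass B" if "flow pos \<le> mass B"
    using that by (intro mult_left_mono) auto
  ultimately show ?thesis
    unfolding b_eq t_def by linarith
qed

subsection \<open>Gibbs mass of the bottleneck\<close>

lemma energy_le: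
  fixes g :: "nat \<Rightarrow> 'i::finite"
  assumes sym: "\<forall>i j. k i j = k j i" and n: "0 < n"
    and k: "\<And>i j. 0 \<le> k i j" "\<And>i j. k i j \<le> \<kappa>"
  shows "2 * real n * energy k g n \<sigma> \<le> \<kappa> * (\<Sum>i\<in>UNIV. \<bar>block_mag g n \<sigma> i\<bar>)\<^sup>2"
proof -
  let ?M = "block_mag g n \<sigma>"
  have "2 * real n * energy k g n \<sigma> \<le> (\<Sum>i\<in>UNIV. \<Sum>j\<in>UNIV. k i j * (?M i * ?M j))"
    unfolding energy_block_mag[OF sym n] using k(1) by (simp add: sum_nonneg)
  also have "\<dots> \<le> (\<Sum>i\<in>UNIV. \<Sum>j\<in>UNIV. \<kappa> * (\<bar>?M i\<bar> * \<bar>?M j\<bar>))"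
  proof (intro sum_mono)
    fix i j
    have "k i j * (?M i * ?M j) \<le> k i j * (\<bar>?M i\<bar> * \<bar>?M j\<bar>)"
      using k(1) by (intro mult_left_mono) (simp_all flip: abs_mult)
    also have "\<dots> \<le> \<kappa> * (\<bar>?M i\<bar> * \<bar>?M j\<bar>)"
      using k(2) by (intro mult_right_mono) auto
    finally show "k i j * (?M i * ?M j) \<le> \<kappa> * (\<bar>?M i\<bar> * \<bar>?M j\<bar>)" .
  qed
  also have "\<dots> = \<kappa> * (\<Sum>i\<in>UNIV. \<bar>?M i\<bar>)\<^sup>2"
    unfolding power2_eq_square sum_product by (simp add: sum_distrib_left)
  finally show ?thesis .
qed

text \<open>The flip replaces each block magnetization by its absolute value and leaves the diagonal
  terms alone. Each pair of blocks gains a nonnegative amount, so every coupling may be replaced by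
  the lower bound \<open>\<kappa>\<close>, after which the double sums are squares.\<close>

lemma energy_flip_blocks_ge:
  fixes g :: "nat \<Rightarrow> 'i::finite"
  assumes sym: "\<forall>i j. k i j = k j i" and n: "0 < n" and k: "\<And>i j. \<kappa> \<le> k i j"
  shows "\<kappa> * ((\<Sum>i\<in>UNIV. \<bar>block_mag g n \<sigma> i\<bar>)\<^sup>2 - (\<Sum>v<n. \<sigma> v)\<^sup>2)
    \<le> 2 * real n * (energy k g n (\<lambda>v. (if block_mag g n \<sigma> (g v) < 0 then -1 else 1) * \<sigma> v)
                      - energy k g n \<sigma>)"
proof -
  let ?M = "block_mag g n \<sigma>"
  define \<tau> where "\<tau> = (\<lambda>v. (if ?M (g v) < 0 then -1 else 1) * \<sigma> v)"
  have \<tau>_sq: "(\<tau> v)\<^sup>2 = (\<sigma> v)\<^sup>2" for v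
    unfolding \<tau>_def by simp
  have M\<tau>: "block_mag g n \<tau> i = \<bar>?M i\<bar>" for i
  proof -
    define c where "c = (if ?M i < 0 then -1 else 1 :: real)"
    have "block_mag g n \<tau> i = (\<Sum>v | v < n \<and> g v = i. c * \<sigma> v)"
      unfolding block_mag_def[of g n \<tau> i] by (rule sum.cong) (auto simp: \<tau>_def c_def)
    also have "\<dots> = c * ?M i"
      unfolding block_mag_def by (simp add: sum_distrib_left)
    finally show ?thesis unfolding c_def by simp
  qed
  have "\<kappa> * ((\<Sum>i\<in>UNIV. \<bar>?M i\<bar>)\<^sup>2 - (\<Sum>v<n. \<sigma> v)\<^sup>2)
      = (\<Sum>i\<in>UNIV. \<Sum>j\<in>UNIV. \<kappa> * (\<bar>?M i\<bar> * \<bar>?M j\<bar> - ?M i * ?M j))"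
    unfolding sum_block_mag[of g n \<sigma>, symmetric]
    unfolding power2_eq_square sum_product
    by (simp add: sum_distrib_left right_diff_distrib sum_subtractf)
  also have "\<dots> \<le> (\<Sum>i\<in>UNIV. \<Sum>j\<in>UNIV. k i j * (\<bar>?M i\<bar> * \<bar>?M j\<bar> - ?M i * ?M j))"
    using k by (intro sum_mono mult_right_mono) (simp_all flip: abs_mult)
  also have "\<dots> = 2 * real n * (energy k g n \<tau> - energy k g n \<sigma>)"
    using energy_block_mag[OF sym n, of g \<tau>] energy_block_mag[OF sym n, of g \<sigma>]
    by (simp add: M\<tau> \<tau>_sq right_diff_distrib sum_subtractf)
  finally show ?thesis unfolding \<tau>_def .
qed

text \<open>Flipping every block of negative magnetization is at most \<open>2 ^ CARD('i)\<close>-to-one, and it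
  raises the energy by order \<open>n\<close> if the block magnetizations are large but nearly cancel.\<close>

lemma flip_sum_le:
  fixes g :: "nat \<Rightarrow> 'i::finite"
  assumes "\<And>\<sigma>. \<sigma> \<in> X \<Longrightarrow> energy k g n \<sigma> + D \<le>
      energy k g n (\<lambda>v. (if block_mag g n \<sigma> (g v) < 0 then -1 else 1) * \<sigma> v)"
    and X: "X \<subseteq> Conf n" and \<beta>: "0 \<le> \<beta>"
  shows "(\<Sum>\<sigma>\<in>X. exp (\<beta> * energy k g n \<sigma>))
    \<le> exp (- \<beta> * D) * (real (card (UNIV :: 'i set set)) * partition_fn \<beta> k g n)"
proof -
  \<comment> \<open>The flipped set of blocks depends on \<open>\<sigma>\<close>. Summing over all
    sets \<open>I\<close> removes this dependence, and for each fixed \<open>I\<close> the flip is a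
    bijection, giving one copy of the partition function.\<close>
  define w where "w I \<sigma> = exp (\<beta> * energy k g n (\<lambda>v. (if g v \<in> I then -1 else 1) * \<sigma> v))" for I \<sigma>
  have "(\<Sum>\<sigma>\<in>X. exp (\<beta> * energy k g n \<sigma>)) \<le> (\<Sum>\<sigma>\<in>X. exp (- \<beta> * D) * (\<Sum>I\<in>UNIV. w I \<sigma>))"
  proof (rule sum_mono)
    fix \<sigma> assume "\<sigma> \<in> X"
    let ?I = "{i. block_mag g n \<sigma> i < 0}"
    have "\<beta> * (energy k g n \<sigma> + D) \<le> \<beta> * energy k g n (\<lambda>v. (if g v \<in> ?I then -1 else 1) * \<sigma> v)"
      using assms(1)[OF \<open>\<sigma> \<in> X\<close>] \<beta> by (intro mult_left_mono) auto
    then have "exp (\<beta> * energy k g n \<sigma>) \<le> exp (- \<beta> * D) * w ?I \<sigma>"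
      unfolding w_def by (simp add: algebra_simps flip: exp_add)
    also have "\<dots> \<le> exp (- \<beta> * D) * (\<Sum>I\<in>UNIV. w I \<sigma>)"
      by (intro mult_left_mono member_le_sum) (auto simp: w_def)
    finally show "exp (\<beta> * energy k g n \<sigma>) \<le> exp (- \<beta> * D) * (\<Sum>I\<in>UNIV. w I \<sigma>)" .
  qed
  also have "\<dots> \<le> (\<Sum>\<sigma>\<in>Conf n. exp (- \<beta> * D) * (\<Sum>I\<in>UNIV. w I \<sigma>))"
    using X finite_Conf by (intro sum_mono2 mult_nonneg_nonneg sum_nonneg) (auto simp: w_def)
  also have "\<dots> = exp (- \<beta> * D) * (\<Sum>I\<in>UNIV. \<Sum>\<sigma>\<in>Conf n. w I \<sigma>)"
    unfolding sum_distrib_left[symmetric] by (subst sum.swap) (rule refl)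
  also have "(\<Sum>I\<in>UNIV. \<Sum>\<sigma>\<in>Conf n. w I \<sigma>) = (\<Sum>I\<in>(UNIV :: 'i set set). partition_fn \<beta> k g n)"
    unfolding w_def by (intro sum.cong refl sum_Conf_mult) auto
  finally show ?thesis by simp
qed

text \<open>The energy has no diagonal terms and is multilinear in the spins, so independence turns
  its mean into the energy of the vector of means.\<close>

lemma product_weight_energy:
  "(\<Sum>\<sigma>\<in>Conf n. product_weight n t \<sigma> * (\<beta> * energy k g n \<sigma>)) = \<beta> * energy k g n t"
proof -
  have "(\<Sum>\<sigma>\<in>Conf n. product_weight n t \<sigma> * (\<beta> * energy k g n \<sigma>))
      = (\<Sum>\<sigma>\<in>Conf n. \<Sum>v<n. \<Sum>w\<in>{v<..<n}. \<beta> * Kint k g n v w * (product_weight n t \<sigma> * (\<sigma> v * \<sigma> w)))"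
    unfolding energy_def by (simp add: sum_distrib_left mult_ac)
  also have "\<dots> = (\<Sum>v<n. \<Sum>w\<in>{v<..<n}. \<Sum>\<sigma>\<in>Conf n. \<beta> * Kint k g n v w * (product_weight n t \<sigma> * (\<sigma> v * \<sigma> w)))"
    by (subst sum.swap) (intro sum.cong refl sum.swap)
  also have "\<dots> = (\<Sum>v<n. \<Sum>w\<in>{v<..<n}. \<beta> * Kint k g n v w * (t v * t w))"
    by (intro sum.cong refl) (simp add: product_weight_pair flip: sum_distrib_left)
  also have "\<dots> = \<beta> * energy k g n t"
    unfolding energy_def by (simp add: sum_distrib_left mult_ac)
  finally show ?thesis .
qed

section \<open>The supercritical regime\<close>

locale supercritical =
  fixes p :: "'i::finite \<Rightarrow> real" and k :: "'i \<Rightarrow> 'i \<Rightarrow> real"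
    and a :: "'i \<Rightarrow> real" and \<beta> :: real
  assumes p_pos: "\<forall>i. p i > 0"
    and p_sum: "(\<Sum>i\<in>UNIV. p i) = 1"
    and k_pos: "\<forall>i j. k i j > 0"
    and k_sym: "\<forall>i j. k i j = k j i"
    and a_perron: "left_perron_vector p k a"
    and beta_gt: "\<beta> > beta_cr p k a"
begin

definition balanced :: "nat \<Rightarrow> (nat \<Rightarrow> 'i) \<Rightarrow> bool" where
  "balanced n g \<longleftrightarrow> (\<forall>i. real (card {v. v < n \<and> g v = i}) = real n * p i)"

definition perron_root :: real where
  "perron_root = (\<Sum>i\<in>UNIV. \<Sum>j\<in>UNIV. a i * p i * k i j)"

lemma a_pos: "0 < a i" and a_sum: "(\<Sum>i\<in>UNIV. a i) = 1"
  using a_perron by (auto simp: left_perron_vector_def)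

lemma a_le_1: "a i \<le> 1"
  using member_le_sum[of i UNIV a] a_pos a_sum by (auto simp: less_imp_le)

text \<open>Summing the eigenvector equation over \<open>j\<close> and using that \<open>a\<close>
  has total mass 1 identifies the eigenvalue as \<open>perron_root\<close>, the reciprocal of
  \<open>beta_cr p k a\<close>.\<close>

lemma perron_eq: "(\<Sum>i\<in>UNIV. a i * (p i * k i j)) = perron_root * a j"
proof -
  obtain r where r: "\<And>j. (\<Sum>i\<in>UNIV. a i * (p i * k i j)) = r * a j"
    using a_perron by (auto simp: left_perron_vector_def)
  have "perron_root = (\<Sum>j\<in>UNIV. \<Sum>i\<in>UNIV. a i * (p i * k i j))"
    unfolding perron_root_def by (subst sum.swap) (simp add: mult.assoc)
  also have "\<dots> = r" by (simp add: r a_sum flip: sum_distrib_left)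
  finally show ?thesis using r by simp
qed

lemma perron_root_pos: "0 < perron_root"
  unfolding perron_root_def using a_pos p_pos k_pos by (intro sum_pos) auto

lemma beta_perron_root: "1 < \<beta> * perron_root"
  using beta_gt perron_root_pos unfolding beta_cr_def perron_root_def[symmetric]
  by (simp add: field_simps)

lemma beta_pos: "0 < \<beta>"
  using beta_perron_root perron_root_pos by (metis less_trans zero_less_mult_pos2 zero_less_one)

lemma k_bounds: obtains \<kappa> K where "0 < \<kappa>" "\<And>i j. \<kappa> \<le> k i j" "\<And>i j. k i j \<le> K"
proof -
  let ?R = "range (\<lambda>(i, j). k i j)"
  have fin: "finite ?R" and mem: "k i j \<in> ?R" for i j by (auto simp: image_iff split: prod.split)
  show thesis
    using fin mem k_pos by (intro that[of "Min ?R" "Max ?R"]) (auto simp: Min_gr_iff)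
qed

lemma balanced_sum:
  assumes "balanced n g"
  shows "(\<Sum>v<n. f (g v)) = real n * (\<Sum>i\<in>UNIV. p i * f i)"
proof -
  have "(\<Sum>v<n. f (g v)) = (\<Sum>i\<in>UNIV. f i * block_mag g n (\<lambda>_. 1) i)"
    using sum_blocks[of f g "\<lambda>_. 1" n] by simp
  also have "\<dots> = real n * (\<Sum>i\<in>UNIV. p i * f i)"
    using assms by (simp add: block_mag_def balanced_def sum_distrib_left mult_ac)
  finally show ?thesis .
qed

text \<open>The product measure with means \<open>\<eta> * a i\<close> on block \<open>i\<close> beats the uniform measure in free
  energy per vertex by \<open>\<eta>\<^sup>2 * (\<beta> * perron_root - 1) / 2 * (\<Sum>i\<in>UNIV. p i * (a i)\<^sup>2)\<close>
  up to order \<open>\<eta>^4\<close>: by the Perron equation, the quadratic form with coefficients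
  \<open>p i * p j * k i j\<close> takes the value \<open>perron_root * (\<Sum>i\<in>UNIV. p i * (a i)\<^sup>2)\<close> at \<open>a\<close>.\<close>

lemma partition_fn_ge:
  obtains \<delta> C where "0 < \<delta>"
    "\<And>n g. \<lbrakk>0 < n; balanced n g\<rbrakk> \<Longrightarrow> exp (real n * (ln 2 + \<delta>) - C) \<le> partition_fn \<beta> k g n"
proof -
  obtain \<kappa> K where K: "\<And>i j. k i j \<le> K" and "\<And>i j. \<kappa> \<le> k i j" "0 < \<kappa>" by (metis k_bounds)
  define x where "x = \<beta> * perron_root - 1"
  \<comment> \<open>Then \<open>\<eta>\<^sup>2 \<le> x\<close> keeps the quartic loss, of relative
    size \<open>\<eta>\<^sup>2 / 3\<close>, below the quadratic gain \<open>x / 2\<close>, and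
    \<open>\<eta> < 1\<close> keeps the means strictly between -1 and 1.\<close>
  define \<eta> where "\<eta> = sqrt (min (1/4) x)"
  define D where "D = (\<Sum>i\<in>UNIV. p i * (a i)\<^sup>2)"
  define D4 where "D4 = (\<Sum>i\<in>UNIV. p i * (a i)^4)"
  have x: "0 < x" unfolding x_def using beta_perron_root by simp
  have \<eta>: "0 < \<eta>" "\<eta> < 1" "\<eta>\<^sup>2 \<le> x"
    unfolding \<eta>_def using x by (auto simp: real_less_lsqrt)
  have D_pos: "0 < D" 
    unfolding D_def using p_pos a_pos by (intro sum_pos mult_pos_pos zero_less_power) auto
  have D4: "D4 \<le> D"
    unfolding D_def D4_def
  proof (intro sum_mono mult_left_mono)
    fix i show "(a i)^4 \<le> (a i)\<^sup>2"
      using a_pos[of i] a_le_1[of i] by (intro power_decreasing) auto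
    show "0 \<le> p i" using p_pos less_imp_le by blast
  qed
  define \<delta> where "\<delta> = \<eta>\<^sup>2 * D * (x / 2 - \<eta>\<^sup>2 / 3)"
  have "0 < x / 2 - \<eta>\<^sup>2 / 3" using \<eta> x by linarith
  then have \<delta>: "0 < \<delta>" unfolding \<delta>_def using \<eta> D_pos by simp
  have "exp (real n * (ln 2 + \<delta>) - \<beta> * K / 2) \<le> partition_fn \<beta> k g n"
    if n: "0 < n" and g: "balanced n g" for n g
  proof -
    define t where "t v = \<eta> * a (g v)" for v
    have t1: "\<bar>t v\<bar> < 1" for v
    proof -
      have "\<eta> * a (g v) \<le> \<eta> * 1" using \<eta> a_le_1 by (intro mult_left_mono) auto
      then have "\<eta> * a (g v) < 1" using \<eta>(2) by linarith
      then show ?thesis unfolding t_def using \<eta>(1) a_pos[of "g v"] by (simp add: abs_mult)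
    qed
    have M: "block_mag g n t i = real n * p i * \<eta> * a i" for i
    proof -
      have "block_mag g n t i = (\<Sum>v | v < n \<and> g v = i. \<eta> * a i)"
        unfolding block_mag_def t_def by (intro sum.cong) auto
      then show ?thesis using g by (simp add: balanced_def)
    qed
    have "(\<Sum>i\<in>UNIV. \<Sum>j\<in>UNIV. k i j * (block_mag g n t i * block_mag g n t j))
        = (\<Sum>j\<in>UNIV. (real n)\<^sup>2 * \<eta>\<^sup>2 * (p j * a j * (\<Sum>i\<in>UNIV. a i * (p i * k i j))))"
      unfolding M by (subst sum.swap) (simp add: sum_distrib_left power2_eq_square mult_ac)
    also have "\<dots> = (real n)\<^sup>2 * \<eta>\<^sup>2 * perron_root * D"
      unfolding perron_eq D_def by (simp add: sum_distrib_left power2_eq_square mult_ac)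
    finally have quad: "(\<Sum>i\<in>UNIV. \<Sum>j\<in>UNIV. k i j * (block_mag g n t i * block_mag g n t j))
        = (real n)\<^sup>2 * \<eta>\<^sup>2 * perron_root * D" .
    \<comment> \<open>The diagonal correction is at most \<open>n * K\<close>; after division by
      \<open>2 * n\<close> it costs only the constant \<open>\<beta> * K / 2\<close> in the
      exponent.\<close>
    have "(\<Sum>v<n. k (g v) (g v) * (t v)\<^sup>2) \<le> (\<Sum>v<n. K * 1)"
    proof (intro sum_mono mult_mono)
      fix v
      show "k (g v) (g v) \<le> K" by (rule K)
      show "(t v)\<^sup>2 \<le> 1" using t1[of v] by (simp add: abs_square_le_1)
      show "0 \<le> K" using K[of "g v" "g v"] k_pos by (meson less_imp_le order_trans)
    qed auto
    then have "(real n)\<^sup>2 * \<eta>\<^sup>2 * perron_root * D - real n * K \<le> 2 * real n * energy k g n t"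
      unfolding energy_block_mag[OF k_sym n] quad by simp
    then have "real n * (real n * \<eta>\<^sup>2 * perron_root * D - K) \<le> real n * (2 * energy k g n t)"
      by (simp add: algebra_simps power2_eq_square)
    then have "real n * \<eta>\<^sup>2 * perron_root * D - K \<le> 2 * energy k g n t"
      using n by simp
    then have "\<beta> * ((real n * \<eta>\<^sup>2 * perron_root * D - K) / 2) \<le> \<beta> * energy k g n t"
      using beta_pos by (intro mult_left_mono) auto
    moreover have "(\<Sum>v<n. ln 2 - (t v)^2/2 - (t v)^4/3)
        = real n * (\<Sum>i\<in>UNIV. p i * (ln 2 - (\<eta> * a i)^2/2 - (\<eta> * a i)^4/3))"
      unfolding t_def by (rule balanced_sum[OF g])
    moreover have "(\<Sum>i\<in>UNIV. p i * (ln 2 - (\<eta> * a i)^2/2 - (\<eta> * a i)^4/3))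
        = ln 2 - \<eta>\<^sup>2 * D / 2 - \<eta>^4 * D4 / 3"
    proof -
      have "(\<Sum>i\<in>UNIV. p i * (ln 2 - (\<eta> * a i)^2/2 - (\<eta> * a i)^4/3))
          = (\<Sum>i\<in>UNIV. p i * ln 2 - \<eta>\<^sup>2 / 2 * (p i * (a i)\<^sup>2) - \<eta>^4 / 3 * (p i * (a i)^4))"
        by (intro sum.cong refl) (simp add: algebra_simps power_mult_distrib)
      then show ?thesis
        unfolding D_def D4_def sum_subtractf sum_distrib_left[symmetric] sum_distrib_right[symmetric]
        by (simp add: p_sum)
    qed
    moreover have "\<eta>^4 * D4 / 3 \<le> \<eta>^4 * D / 3"
      using D4 by (intro divide_right_mono mult_left_mono) auto
    moreover have "\<beta> * ((real n * \<eta>\<^sup>2 * perron_root * D - K) / 2) + real n * (ln 2 - \<eta>\<^sup>2 * D / 2 - \<eta>^4 * D / 3)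
        = real n * (ln 2 + \<delta>) - \<beta> * K / 2"
      unfolding \<delta>_def x_def by (simp add: field_simps power2_eq_square power4_eq_xxxx)
    moreover have "real n * (ln 2 - \<eta>\<^sup>2 * D / 2 - \<eta>^4 * D / 3) \<le> real n * (ln 2 - \<eta>\<^sup>2 * D / 2 - \<eta>^4 * D4 / 3)"
      using calculation(4) by (intro mult_left_mono) auto
    ultimately have "real n * (ln 2 + \<delta>) - \<beta> * K / 2
        \<le> \<beta> * energy k g n t + (\<Sum>v<n. ln 2 - (t v)^2/2 - (t v)^4/3)"
      by simp
    then have "exp (real n * (ln 2 + \<delta>) - \<beta> * K / 2)
        \<le> exp (\<beta> * energy k g n t + (\<Sum>v<n. ln 2 - (t v)^2/2 - (t v)^4/3))"
      by simp
    also have "\<dots> \<le> partition_fn \<beta> k g n"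
      using sum_exp_ge_product_weight[of n t "\<lambda>\<sigma>. \<beta> * energy k g n \<sigma>"] t1
      unfolding product_weight_energy by simp
    finally show ?thesis .
  qed
  then show thesis using that \<delta> by blast
qed

lemma gibbs_boundary_le:
  obtains c C where "0 < c" "0 < C"
    "\<And>n g. \<lbrakk>0 < n; balanced n g\<rbrakk> \<Longrightarrow>
      (\<Sum>\<sigma> | \<sigma> \<in> Conf n \<and> \<bar>\<Sum>v<n. \<sigma> v\<bar> \<le> 2. gibbs \<beta> k g n \<sigma>) \<le> C * exp (- c * real n)"
proof -
  obtain \<kappa> K where \<kappa>: "0 < \<kappa>" "\<And>i j. \<kappa> \<le> k i j" and K: "\<And>i j. k i j \<le> K" by (metis k_bounds)
  have K_pos: "0 < K" using \<kappa>(1) \<kappa>(2)[of undefined undefined] K[of undefined undefined] by linarith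
  obtain \<delta> C0 where \<delta>: "0 < \<delta>" and Z: "\<And>n g. \<lbrakk>0 < n; balanced n g\<rbrakk> \<Longrightarrow>
      exp (real n * (ln 2 + \<delta>) - C0) \<le> partition_fn \<beta> k g n"
    using partition_fn_ge by blast
  \<comment> \<open>Chosen so that a configuration with
    \<open>s \<sigma> < \<epsilon> * real n\<close> has weight at most
    \<open>exp (n * \<delta> / 2)\<close>, using up only half of the surplus \<open>\<delta>\<close>
    of the partition function over \<open>2 ^ n\<close>.\<close>
  define \<epsilon> where "\<epsilon> = sqrt (\<delta> / (\<beta> * K))"
  have \<epsilon>: "0 < \<epsilon>" "\<beta> * K * \<epsilon>\<^sup>2 = \<delta>"
    unfolding \<epsilon>_def using \<delta> beta_pos K_pos by auto
  define N where "N = real (card (UNIV :: 'i set set))"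
  \<comment> \<open>The two rates come from the small and the big magnetizations respectively, and
    so do the two summands of \<open>C\<close>.\<close>
  define c where "c = min (\<delta> / 2) (\<beta> * \<kappa> * \<epsilon>\<^sup>2 / 2)"
  define C where "C = exp C0 + exp (2 * \<beta> * \<kappa>) * N"
  have c: "0 < c" unfolding c_def using \<delta> \<epsilon> beta_pos \<kappa> by simp
  have C: "0 < C" unfolding C_def N_def by (simp add: add_pos_nonneg)
  have "(\<Sum>\<sigma> | \<sigma> \<in> Conf n \<and> \<bar>\<Sum>v<n. \<sigma> v\<bar> \<le> 2. gibbs \<beta> k g n \<sigma>) \<le> C * exp (- c * real n)"
    if n: "0 < n" and g: "balanced n g" for n g
  proof -
    define s where "s \<sigma> = (\<Sum>i\<in>UNIV. \<bar>block_mag g n \<sigma> i\<bar>)" for \<sigma>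
    define w where "w \<sigma> = exp (\<beta> * energy k g n \<sigma>)" for \<sigma>
    define B where "B = {\<sigma>. \<sigma> \<in> Conf n \<and> \<bar>\<Sum>v<n. \<sigma> v\<bar> \<le> 2}"
    define Big where "Big = {\<sigma> \<in> B. \<epsilon> * real n \<le> s \<sigma>}"
    define Small where "Small = {\<sigma> \<in> B. s \<sigma> < \<epsilon> * real n}"
    let ?Z = "partition_fn \<beta> k g n"
    have n1: "1 \<le> real n" using n by simp
    have fin: "finite B" unfolding B_def using finite_Conf by simp
    have Z_pos: "0 < ?Z" by (rule partition_fn_pos)
    have split: "(\<Sum>\<sigma>\<in>B. w \<sigma>) = (\<Sum>\<sigma>\<in>Small. w \<sigma>) + (\<Sum>\<sigma>\<in>Big. w \<sigma>)"
    proof -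
      have B_eq: "B = Small \<union> Big" unfolding Small_def Big_def by auto
      show ?thesis
        unfolding B_eq using fin by (intro sum.union_disjoint) (auto simp: Small_def Big_def)
    qed
    have small: "(\<Sum>\<sigma>\<in>Small. w \<sigma>) \<le> exp C0 * exp (- c * real n) * ?Z"
    proof -
      have "w \<sigma> \<le> exp (real n * (\<delta> / 2))" if "\<sigma> \<in> Small" for \<sigma>
      proof -
        have s: "0 \<le> s \<sigma>" "s \<sigma> \<le> \<epsilon> * real n"
          using that unfolding Small_def s_def by (auto intro: sum_nonneg)
        have "2 * real n * energy k g n \<sigma> \<le> K * (s \<sigma>)\<^sup>2"
          unfolding s_def by (intro energy_le k_sym n K) (use k_pos less_imp_le in blast)
        also have "\<dots> \<le> K * (\<epsilon> * real n)\<^sup>2"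
          using s K_pos by (intro mult_left_mono power_mono) auto
        finally have "real n * (2 * energy k g n \<sigma>) \<le> real n * (K * \<epsilon>\<^sup>2 * real n)"
          by (simp add: power2_eq_square mult_ac)
        then have "2 * energy k g n \<sigma> \<le> K * \<epsilon>\<^sup>2 * real n" using n by simp
        then have "\<beta> * (2 * energy k g n \<sigma>) \<le> \<beta> * (K * \<epsilon>\<^sup>2 * real n)"
          using beta_pos by (intro mult_left_mono) auto
        also have "\<dots> = \<delta> * real n" using \<epsilon>(2) by (simp add: mult_ac)
        finally show ?thesis unfolding w_def by (simp add: mult_ac)
      qed
      then have "(\<Sum>\<sigma>\<in>Small. w \<sigma>) \<le> real (card Small) * exp (real n * (\<delta> / 2))"
        by (rule sum_bounded_above)
      also have "real (card Small) \<le> 2 ^ n"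
        unfolding card_Conf[symmetric] of_nat_le_iff
        by (rule card_mono[OF finite_Conf]) (auto simp: Small_def B_def)
      also have "2 ^ n * exp (real n * (\<delta> / 2)) = exp (real n * ln 2 + real n * (\<delta> / 2))"
        by (simp add: exp_add exp_of_nat_mult)
      also have "\<dots> = exp (C0 - real n * (\<delta> / 2)) * exp (real n * (ln 2 + \<delta>) - C0)"
        unfolding exp_add[symmetric] by (simp add: algebra_simps)
      also have "\<dots> \<le> exp (C0 - c * real n) * ?Z"
      proof (intro mult_mono Z n g)
        have "c * real n \<le> \<delta> / 2 * real n" unfolding c_def by (intro mult_right_mono) auto
        then show "exp (C0 - real n * (\<delta> / 2)) \<le> exp (C0 - c * real n)" by (simp add: mult_ac)
      qed auto
      finally show ?thesis by (simp add: exp_diff exp_minus field_simps)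
    qed
    have big: "(\<Sum>\<sigma>\<in>Big. w \<sigma>) \<le> exp (2 * \<beta> * \<kappa>) * N * exp (- c * real n) * ?Z"
    proof -
      \<comment> \<open>The gain \<open>\<kappa> * ((\<epsilon> * n)\<^sup>2 - 4) / (2 * n)\<close>
        from \<open>energy_flip_blocks_ge\<close>, with 4 weakened to \<open>4 * n\<close> to make
        it linear in \<open>n\<close>.\<close>
      let ?D = "\<kappa> * \<epsilon>\<^sup>2 / 2 * real n - 2 * \<kappa>"
      have "energy k g n \<sigma> + ?D \<le>
          energy k g n (\<lambda>v. (if block_mag g n \<sigma> (g v) < 0 then -1 else 1) * \<sigma> v)" (is "_ \<le> ?E")
        if \<sigma>: "\<sigma> \<in> Big" for \<sigma>
      proof -
        have "(\<epsilon> * real n)\<^sup>2 \<le> (s \<sigma>)\<^sup>2"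
          using \<sigma> \<epsilon> unfolding Big_def by (intro power_mono) auto
        moreover have "(\<Sum>v<n. \<sigma> v)\<^sup>2 \<le> 2\<^sup>2"
          using \<sigma> unfolding Big_def B_def by (intro abs_le_square_iff[THEN iffD1]) auto
        ultimately have "(\<epsilon> * real n)\<^sup>2 - 4 * real n \<le> (s \<sigma>)\<^sup>2 - (\<Sum>v<n. \<sigma> v)\<^sup>2"
          using n1 by simp
        then have "\<kappa> * ((\<epsilon> * real n)\<^sup>2 - 4 * real n) \<le> \<kappa> * ((s \<sigma>)\<^sup>2 - (\<Sum>v<n. \<sigma> v)\<^sup>2)"
          using \<kappa> by (intro mult_left_mono) auto
        also have "\<dots> \<le> 2 * real n * (?E - energy k g n \<sigma>)"
          unfolding s_def by (rule energy_flip_blocks_ge[OF k_sym n \<kappa>(2)])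
        finally have "2 * real n * ?D \<le> 2 * real n * (?E - energy k g n \<sigma>)"
          by (simp add: algebra_simps power2_eq_square)
        then have "?D \<le> ?E - energy k g n \<sigma>" using n by simp
        then show ?thesis by simp
      qed
      then have "(\<Sum>\<sigma>\<in>Big. w \<sigma>) \<le> exp (- \<beta> * ?D) * (N * ?Z)"
        unfolding w_def N_def using beta_pos by (intro flip_sum_le) (auto simp: Big_def B_def)
      also have "\<dots> \<le> exp (2 * \<beta> * \<kappa> - c * real n) * (N * ?Z)"
      proof (intro mult_right_mono)
        have "c * real n \<le> \<beta> * \<kappa> * \<epsilon>\<^sup>2 / 2 * real n" unfolding c_def by (intro mult_right_mono) auto
        then show "exp (- \<beta> * ?D) \<le> exp (2 * \<beta> * \<kappa> - c * real n)" by (simp add: algebra_simps)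
        show "0 \<le> N * ?Z" using Z_pos unfolding N_def by simp
      qed
      finally show ?thesis by (simp add: exp_diff exp_minus field_simps)
    qed
    have "(\<Sum>\<sigma>\<in>B. w \<sigma>) \<le> C * exp (- c * real n) * ?Z"
      using small big unfolding split C_def by (simp add: algebra_simps)
    then have "(\<Sum>\<sigma>\<in>B. w \<sigma>) / ?Z \<le> C * exp (- c * real n)"
      using Z_pos by (simp add: divide_le_eq)
    then show ?thesis
      unfolding gibbs_def B_def w_def by (simp add: sum_divide_distrib)
  qed
  then show thesis using that c C by blast
qed

lemma mixing_time_exponential:
  "\<exists>c>0. \<exists>N. \<forall>n\<ge>N. \<forall>g. balanced n g \<longrightarrow> exp (c * real n) \<le> real (mixing_time \<beta> k g n)"
proof -
  obtain c C where c: "0 < c" and C: "0 < C" and bound: "\<And>n g. \<lbrakk>0 < n; balanced n g\<rbrakk> \<Longrightarrow>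
      (\<Sum>\<sigma> | \<sigma> \<in> Conf n \<and> \<bar>\<Sum>v<n. \<sigma> v\<bar> \<le> 2. gibbs \<beta> k g n \<sigma>) \<le> C * exp (- c * real n)"
    using gibbs_boundary_le by blast
  \<comment> \<open>The first threshold lets half of the exponent absorb the factor
    \<open>16 * C\<close>, whence the final rate \<open>c / 2\<close>; the second makes the
    bottleneck mass at most 1/2; \<open>Suc\<close> forces \<open>n > 0\<close>.\<close>
  define N where "N = Suc (nat \<lceil>2 * ln (16 * C) / c\<rceil> + nat \<lceil>ln (2 * C) / c\<rceil>)"
  have "exp (c / 2 * real n) \<le> real (mixing_time \<beta> k g n)" if nN: "N \<le> n" and g: "balanced n g" for n g
  proof -
    have n: "0 < n" using nN unfolding N_def by simp
    have "2 * ln (16 * C) / c \<le> real n" "ln (2 * C) / c \<le> real n"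
      using nN unfolding N_def by linarith+
    then have "ln (16 * C) \<le> c / 2 * real n" "ln (2 * C) \<le> c * real n"
      using c by (simp_all add: field_simps)
    then have "exp (ln (16 * C)) \<le> exp (c / 2 * real n)" "exp (ln (2 * C)) \<le> exp (c * real n)"
      by simp_all
    then have big: "16 * C \<le> exp (c / 2 * real n)" "2 * C \<le> exp (c * real n)"
      using C by simp_all
    define b where "b = (\<Sum>\<sigma> | \<sigma> \<in> Conf n \<and> \<bar>\<Sum>v<n. \<sigma> v\<bar> \<le> 2. gibbs \<beta> k g n \<sigma>)"
    define T where "T = real (mixing_time \<beta> k g n)"
    have b_le: "b \<le> C * exp (- c * real n)"
      unfolding b_def using bound[OF n g] .
    also have "\<dots> \<le> 1/2"
      using big(2) by (simp add: exp_minus field_simps)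
    finally have "1/16 \<le> (1 - b) / 8" by simp
    also have "\<dots> \<le> T * b"
      unfolding T_def by (rule mixing_time_bottleneck[OF k_sym n b_def])
    also have "\<dots> \<le> T * (C * exp (- c * real n))"
      using b_le unfolding T_def by (intro mult_left_mono) auto
    finally have "exp (c * real n) \<le> T * (16 * C)"
      by (simp add: exp_minus field_simps)
    also have "\<dots> \<le> T * exp (c / 2 * real n)"
      using big(1) unfolding T_def by (intro mult_left_mono) auto
    finally have "exp (c / 2 * real n) * exp (c / 2 * real n) \<le> T * exp (c / 2 * real n)"
      by (simp flip: exp_add)
    then show ?thesis unfolding T_def by simp
  qed
  then show ?thesis using c by (intro exI[of _ "c / 2"] conjI exI[of _ N]) auto
qed

end

theorem theorem3p5:
  fixes p :: "'i::finite \<Rightarrow> real" and k :: "'i \<Rightarrow> 'i \<Rightarrow> real"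
    and a :: "'i \<Rightarrow> real" and \<beta> :: real
  assumes p_pos: "\<forall>i. p i > 0"
    and p_sum: "(\<Sum>i\<in>UNIV. p i) = 1"
    and k_pos: "\<forall>i j. k i j > 0"
    and k_sym: "\<forall>i j. k i j = k j i"
    and a_perron: "left_perron_vector p k a"
    and beta_gt: "\<beta> > beta_cr p k a"
  shows "\<exists>c>0. \<exists>N. \<forall>n\<ge>N. \<forall>g :: nat \<Rightarrow> 'i.
           (\<forall>i. real (card {v. v < n \<and> g v = i}) = real n * p i) \<longrightarrow>
           exp (c * real n) \<le> real (mixing_time \<beta> k g n)"
proof -
  interpret supercritical p k a \<beta>
    using assms by unfold_locales
  show ?thesis using mixing_time_exponential unfolding balanced_def .
qed

end
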